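(* Let $r\ge2$ and let $P$ be an arbitrary collectable $r$-pattern. Let $\mathbb{RM}^{(r)}_n$ be an ordered $r$-matching chosen uniformly at random among all $\frac{(rn)!}{(r!)^n n!}$ ordered $r$-matchings on $[rn]$. Then there are constants $0<c\le C$ depending only on $r$ such that, with probability tending to $1$ as $n\to\infty$, the maximum size of a $P$-clique contained in $\mathbb{RM}^{(r)}_n$ lies between $cn^{1/r}$ and $Cn^{1/r}$.
   Context: An ordered $r$-matching on $[rn]$ is a set of $n$ pairwise disjoint $r$-element subsets (edges) of $[rn]$ covering $[rn]$. An $r$-pattern is an ordered $r$-matching of size two, up to order-isomorphism (written as a word in letters $A,B$ each occurring $r$ times). Two edges $e,f$ form pattern $P$ if $\{e,f\}$ with the induced order is order-isomorphic to $P$. A $P$-clique is a matching in which every pair of edges forms $P$; a $P$-clique in a matching $M$ is a sub-matching of $M$ which is a $P$-clique. A pattern $P$ is collectable if for every $k\ge2$ a $P$-clique of size $k$ exists. *)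

theory Defs
  imports "HOL-Probability.Probability"
begin

definition ordered_matchings :: "nat \<Rightarrow> nat \<Rightarrow> nat set set set" where
  "ordered_matchings r n =
     {M. partition_on {1..r * n} M \<and> card M = n \<and> (\<forall>e\<in>M. card e = r)}"

definition order_isomorphic :: "nat set set \<Rightarrow> nat set set \<Rightarrow> bool" where
  "order_isomorphic M N \<longleftrightarrow>
     (\<exists>\<phi>. bij_betw \<phi> (\<Union>M) (\<Union>N) \<and> strict_mono_on (\<Union>M) \<phi> \<and> (`) \<phi> ` M = N)"

text \<open>
  Every order-isomorphism class of ordered \<open>r\<close>-matchings of size two has exactly one
  representative on \<open>{1..2r}\<close>, so a pattern is encoded by that representative. Its two edges
  are the sets of positions of the two letters in the word notation; being a set of sets,
  it does not distinguish a word from the one obtained by swapping the letters.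
\<close>

definition is_pattern :: "nat \<Rightarrow> nat set set \<Rightarrow> bool" where
  "is_pattern r P \<longleftrightarrow> P \<in> ordered_matchings r 2"

definition forms_pattern :: "nat set set \<Rightarrow> nat set \<Rightarrow> nat set \<Rightarrow> bool" where
  "forms_pattern P e f \<longleftrightarrow> order_isomorphic {e, f} P"

text \<open>
  A clique may live on any finite set of naturals, so that sub-matchings of a matching qualify
  without relabelling. Matchings with at most one edge are cliques for every pattern.
\<close>

definition is_clique :: "nat \<Rightarrow> nat set set \<Rightarrow> nat set set \<Rightarrow> bool" where
  "is_clique r P K \<longleftrightarrow>
     finite K \<and> disjoint K \<and> (\<forall>e\<in>K. card e = r) \<and>
     (\<forall>e\<in>K. \<forall>f\<in>K. e \<noteq> f \<longrightarrow> forms_pattern P e f)"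

definition collectable :: "nat \<Rightarrow> nat set set \<Rightarrow> bool" where
  "collectable r P \<longleftrightarrow> (\<forall>k\<ge>2. \<exists>K. is_clique r P K \<and> card K = k)"

definition max_clique_size :: "nat \<Rightarrow> nat set set \<Rightarrow> nat set set \<Rightarrow> nat" where
  "max_clique_size r P M = Max {card K | K. K \<subseteq> M \<and> is_clique r P K}"

text \<open>
  The next two facts make \<open>pmf_of_set (ordered_matchings r n)\<close> the genuine uniform
  distribution; the third does the same for the maximum.
\<close>

lemma finite_ordered_matchings: "finite (ordered_matchings r n)"
proof (rule finite_subset)
  show "ordered_matchings r n \<subseteq> Pow (Pow {1..r * n})"
    by (auto simp: ordered_matchings_def partition_on_def)
qed simp

lemma ordered_matchings_nonempty:
  assumes "r > 0"
  shows "ordered_matchings r n \<noteq> {}"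
proof (induction n)
  case 0
  show ?case by (auto simp: ordered_matchings_def partition_on_def disjoint_def)
next
  case (Suc n)
  then obtain M where M: "partition_on {1..r * n} M" "card M = n" "\<forall>e\<in>M. card e = r"
    by (auto simp: ordered_matchings_def)
  define e where "e = {r * n + 1..r * n + r}"
  have U: "{1..r * Suc n} = {1..r * n} \<union> e"
    by (auto simp: e_def)
  have ne: "e \<noteq> {}" and dj: "{1..r * n} \<inter> e = {}"
    using assms by (auto simp: e_def)
  have "finite M"
    using M(1) finite_elements by blast
  moreover have "e \<notin> M"
    using M(1) ne dj by (auto simp: partition_on_def)
  ultimately have "card (insert e M) = Suc n"
    using M(2) by simp
  moreover have "partition_on {1..r * Suc n} (insert e M)"
    using M(1) ne dj unfolding U partition_on_def disjoint_def by auto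
  ultimately have "insert e M \<in> ordered_matchings r (Suc n)"
    using M(3) by (auto simp: ordered_matchings_def e_def)
  then show ?case by blast
qed

lemma clique_sizes_finite_nonempty:
  assumes "M \<in> ordered_matchings r n"
  shows "finite {card K | K. K \<subseteq> M \<and> is_clique r P K}"
    and "{card K | K. K \<subseteq> M \<and> is_clique r P K} \<noteq> {}"
proof -
  have "finite M"
    using assms finite_elements by (auto simp: ordered_matchings_def)
  then show "finite {card K | K. K \<subseteq> M \<and> is_clique r P K}"
    by simp
  have "is_clique r P {}"
    by (simp add: is_clique_def disjoint_def)
  then show "{card K | K. K \<subseteq> M \<and> is_clique r P K} \<noteq> {}"
    by blast
qed

end

theory Submission imports Defs begin

text \<open>
  Upper bound: in a clique the rank of every element of the edge containing the minimum of
  the vertex set is dictated by the pattern, so a vertex set carries at most one clique. By the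
  union bound a clique of size \<open>k\<close> is present with probability at most
  \<open>n\<^sup>k / (k!)\<^sup>r\<close>.

  Lower bound: take a template clique with \<open>m \<approx> n\<^sup>1\<^sup>/\<^sup>r\<close> edges and blow up each of
  its \<open>r m\<close> vertices to an interval of length \<open>n div m\<close>. Choosing for each template edge
  an edge of the matching that is transversal to its \<open>r\<close> intervals, where there is one, gives a
  clique. If \<open>Y\<^sub>a\<close> counts the edges transversal to the template edge \<open>a\<close>, at least
  \<open>\<Sum>\<^sub>a Y\<^sub>a - \<Sum>\<^sub>a (Y\<^sub>a choose 2)\<close> template edges are hit, and both sums are
  concentrated by Chebyshev's inequality.
\<close>

section \<open>Counting matchings that contain a given submatching\<close>

text \<open>Edges of a random matching are dependent. What replaces independence is exact counting:
  transversals of different template edges never meet, so joint averages of binomials in the Y_a are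
  numbers of submatchings times one edge probability. The remaining correlation is
  \<open>edge_prob r n (2 * s)\<close> against the square of \<open>edge_prob r n s\<close>, and
  their quotient tends to 1. The events Y_a > 0 have no such explicit averages, which is why Y_a and
  (Y_a choose 2) are used instead. The scale is forced: a fixed r-set is an edge with probability
  about \<rho> / n^(r-1), where \<rho> is \<open>edge_rate r\<close>, and a template edge has about
  (n/m)^r transversals. So Y_a averages about \<rho> n / m^r, a constant exactly when m is of order
  n^(1/r). Since \<rho> \<le> 1/2, the pairs average at most about \<rho>^2 / 2 \<le> \<rho> / 4, so
  about three quarters of \<rho> m template edges survive their subtraction. At y = n^(1/r) the
  union bound reads (y^k / k!)^r, which collapses once k exceeds a multiple of e y. Both constants
  come out independent of the pattern.\<close>

definition matchings :: "nat \<Rightarrow> 'a set \<Rightarrow> 'a set set set" where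
  "matchings r V = {M. partition_on V M \<and> (\<forall>e\<in>M. card e = r)}"

text \<open>This is (r n)! / ((r!)^n n!) in factored form for r > 0: the factor at \<open>i\<close>
  counts the possible edges through one fixed vertex while \<open>i\<close> edges remain to be
  placed.\<close>

definition matching_count :: "nat \<Rightarrow> nat \<Rightarrow> nat" where
  "matching_count r n = (\<Prod>i=1..n. (r * i - 1) choose (r - 1))"

lemma matching_count_pos: "r > 0 \<Longrightarrow> matching_count r n > 0"
  unfolding matching_count_def by (intro prod_pos) (auto simp: zero_less_binomial_iff intro!: diff_le_mono)

lemma finite_matchings: "finite V \<Longrightarrow> finite (matchings r V)"
  by (rule finite_subset[of _ "Pow (Pow V)"]) (auto simp: matchings_def partition_on_def)

lemma card_uniform_partition:
  assumes "finite V" "partition_on V M" "\<forall>e\<in>M. card e = r"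
  shows "card V = r * card M"
proof -
  have "card V = card (\<Union>M)" using assms by (simp add: partition_on_def)
  also have "\<dots> = (\<Sum>e\<in>M. card e)"
    using assms finite_elements[OF assms(1,2)]
    by (intro card_Union_disjoint) (auto simp: partition_on_def disjoint_def pairwise_def disjnt_def intro: finite_subset)
  also have "\<dots> = r * card M" using assms by simp
  finally show ?thesis .
qed

text \<open>Deleting edges from a matching leaves a vertex set that need not be an initial segment,
  so the counting is done on arbitrary \<open>V\<close>. The number of edges is then forced by
  \<open>card V\<close>.\<close>

lemma ordered_matchings_eq:
  assumes "r > 0"
  shows "ordered_matchings r n = matchings r {1..r * n}"
  using card_uniform_partition[of "{1..r*n}" _ r] assms
  by (auto simp: ordered_matchings_def matchings_def)

text \<open>Fixing the edges in \<open>Q\<close> leaves a free matching of the other vertices. Edges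
  are nonempty, so an edge avoiding the vertices of \<open>Q\<close> cannot lie in \<open>Q\<close>;
  hence adding \<open>Q\<close> back undoes its removal.\<close>

lemma bij_betw_matchings_superset:
  assumes "disjoint Q" "\<forall>e\<in>Q. card e = r" "\<Union>Q \<subseteq> V" "r > 0"
  shows "bij_betw (\<lambda>M. M - Q) {M \<in> matchings r V. Q \<subseteq> M} (matchings r (V - \<Union>Q))"
proof (rule bij_betw_byWitness[where f' = "\<lambda>M. M \<union> Q"])
  have ne: "{} \<notin> Q" using assms by auto
  show "\<forall>a\<in>{M \<in> matchings r V. Q \<subseteq> M}. a - Q \<union> Q = a" by auto
  show "\<forall>a'\<in>matchings r (V - \<Union> Q). a' \<union> Q - Q = a'"
  proof
    fix M assume M: "M \<in> matchings r (V - \<Union> Q)"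
    have "e \<notin> Q" if "e \<in> M" for e
    proof
      assume "e \<in> Q"
      moreover have "e \<subseteq> V - \<Union>Q" "e \<noteq> {}" using M that by (auto simp: matchings_def partition_on_def)
      ultimately show False by auto
    qed
    then show "M \<union> Q - Q = M" by auto
  qed
  show "(\<lambda>M. M - Q) ` {M \<in> matchings r V. Q \<subseteq> M} \<subseteq> matchings r (V - \<Union> Q)"
  proof clarify
    fix M assume M: "M \<in> matchings r V" "Q \<subseteq> M"
    have dj: "e \<inter> f = {}" if "e \<in> M" "f \<in> M" "e \<noteq> f" for e f
      using M that by (auto simp: matchings_def partition_on_def disjoint_def)
    have "\<Union>(M - Q) = \<Union>M - \<Union>Q"
    proof
      show "\<Union>(M - Q) \<subseteq> \<Union>M - \<Union>Q" using dj M(2) by blast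
    qed auto
    then show "M - Q \<in> matchings r (V - \<Union> Q)"
      using M by (auto simp: matchings_def partition_on_def disjoint_def)
  qed
  show "(\<lambda>M. M \<union> Q) ` matchings r (V - \<Union> Q) \<subseteq> {M \<in> matchings r V. Q \<subseteq> M}"
  proof clarify
    fix M assume M: "M \<in> matchings r (V - \<Union> Q)"
    then have "\<Union>M = V - \<Union>Q" by (auto simp: matchings_def partition_on_def)
    then have U: "\<Union>(M \<union> Q) = V" and X: "\<And>e f. e \<in> M \<Longrightarrow> f \<in> Q \<Longrightarrow> e \<inter> f = {}"
      using assms(3) by blast+
    have "disjoint (M \<union> Q)"
      using X M assms(1) unfolding matchings_def partition_on_def
      by (intro disjoint_union) (auto simp: disjoint_def)
    then show "M \<union> Q \<in> matchings r V \<and> Q \<subseteq> M \<union> Q"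
      using U M ne assms(2) by (auto simp: matchings_def partition_on_def)
  qed
qed

lemma card_subsets_containing:
  assumes "finite V" "v \<in> V" "r > 0"
  shows "card {e. e \<subseteq> V \<and> v \<in> e \<and> card e = r} = (card V - 1) choose (r - 1)"
proof -
  have "{e. e \<subseteq> V \<and> v \<in> e \<and> card e = r} = insert v ` {e. e \<subseteq> V - {v} \<and> card e = r - 1}"
  proof (intro equalityI subsetI)
    fix e assume e: "e \<in> {e. e \<subseteq> V \<and> v \<in> e \<and> card e = r}"
    then have "e = insert v (e - {v})" by auto
    moreover have "e - {v} \<in> {e. e \<subseteq> V - {v} \<and> card e = r - 1}"
      using e by (auto simp: card_Diff_singleton)
    ultimately show "e \<in> insert v ` {e. e \<subseteq> V - {v} \<and> card e = r - 1}" by blast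
  next
    fix e assume "e \<in> insert v ` {e. e \<subseteq> V - {v} \<and> card e = r - 1}"
    then obtain d where d: "e = insert v d" "d \<subseteq> V - {v}" "card d = r - 1" by auto
    moreover have "finite d" using d(2) assms(1) by (meson finite_Diff finite_subset)
    ultimately show "e \<in> {e. e \<subseteq> V \<and> v \<in> e \<and> card e = r}"
      using assms by (subst d(1)) (auto simp: card_insert_if)
  qed
  moreover have "inj_on (insert v) {e. e \<subseteq> V - {v} \<and> card e = r - 1}"
    by (auto simp: inj_on_def)
  ultimately have "card {e. e \<subseteq> V \<and> v \<in> e \<and> card e = r} = card {e. e \<subseteq> V - {v} \<and> card e = r - 1}"
    by (simp add: card_image)
  also have "\<dots> = (card V - 1) choose (r - 1)"
    using assms by (subst n_subsets) (auto simp: card_Diff_singleton)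
  finally show ?thesis .
qed

text \<open>Matchings are sorted by the edge through a fixed vertex. Removing that edge leaves a
  smaller instance on some other vertex set, hence the generalisation over \<open>V\<close> in the
  induction.\<close>

lemma card_matchings:
  assumes "r > 0" "finite V" "card V = r * n"
  shows "card (matchings r V) = matching_count r n"
  using assms
proof (induction n arbitrary: V)
  case 0
  then have "V = {}" by simp
  then have "matchings r V = {{}}"
    by (auto simp: matchings_def partition_on_def disjoint_def)
  then show ?case by (simp add: matching_count_def)
next
  case (Suc n)
  then obtain v where v: "v \<in> V" by fastforce
  define E where "E = {e. e \<subseteq> V \<and> v \<in> e \<and> card e = r}"
  have fE: "finite E" using Suc.prems by (auto simp: E_def)
  have U: "matchings r V = (\<Union>e\<in>E. {M \<in> matchings r V. {e} \<subseteq> M})"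
  proof (intro equalityI subsetI)
    fix M assume M: "M \<in> matchings r V"
    then obtain e where "e \<in> M" "v \<in> e" using v by (auto simp: matchings_def partition_on_def)
    then show "M \<in> (\<Union>e\<in>E. {M \<in> matchings r V. {e} \<subseteq> M})"
      using M by (auto simp: E_def matchings_def partition_on_def)
  qed auto
  have "card (\<Union>e\<in>E. {M \<in> matchings r V. {e} \<subseteq> M}) = (\<Sum>e\<in>E. card {M \<in> matchings r V. {e} \<subseteq> M})"
  proof (rule card_UN_disjoint[OF fE])
    show "\<forall>e\<in>E. finite {M \<in> matchings r V. {e} \<subseteq> M}"
      using finite_matchings[OF Suc.prems(2)] by simp
    show "\<forall>i\<in>E. \<forall>j\<in>E. i \<noteq> j \<longrightarrow>
       {M \<in> matchings r V. {i} \<subseteq> M} \<inter> {M \<in> matchings r V. {j} \<subseteq> M} = {}"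
    proof (intro ballI impI equals0I)
      fix i j M assume ij: "i \<in> E" "j \<in> E" "i \<noteq> j"
        and M: "M \<in> {M \<in> matchings r V. {i} \<subseteq> M} \<inter> {M \<in> matchings r V. {j} \<subseteq> M}"
      have "i \<in> M" "j \<in> M" "disjoint M" using M by (simp_all add: matchings_def partition_on_def)
      then have "i \<inter> j = {}" using ij(3) by (rule_tac disjointD)
      moreover have "v \<in> i" "v \<in> j" using ij by (simp_all add: E_def)
      ultimately show False by blast
    qed
  qed
  also have "\<dots> = (\<Sum>e\<in>E. matching_count r n)"
  proof (rule sum.cong)
    fix e assume e: "e \<in> E"
    have "card {M \<in> matchings r V. {e} \<subseteq> M} = card (matchings r (V - e))"
      using bij_betw_same_card[OF bij_betw_matchings_superset[of "{e}" r V]] e Suc.prems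
      by (auto simp: E_def disjoint_def)
    also have "\<dots> = matching_count r n"
      using e Suc.prems by (intro Suc.IH) (auto simp: E_def card_Diff_subset finite_subset)
    finally show "card {M \<in> matchings r V. {e} \<subseteq> M} = matching_count r n" .
  qed simp
  also have "\<dots> = matching_count r (Suc n)"
    using card_subsets_containing[OF Suc.prems(2) v Suc.prems(1)] Suc.prems(3)
    by (simp add: E_def matching_count_def)
  finally show ?case unfolding U[symmetric] .
qed

lemma card_matchings_superset:
  assumes "r > 0" "finite V" "card V = r * n"
    and "disjoint Q" "\<forall>e\<in>Q. card e = r" "\<Union>Q \<subseteq> V"
  shows "card {M \<in> matchings r V. Q \<subseteq> M} = matching_count r (n - card Q)"
proof -
  have fU: "finite (\<Union>Q)" using assms finite_subset by blast
  have "partition_on (\<Union>Q) Q"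
    using assms by (auto simp: partition_on_def)
  then have "card (\<Union>Q) = r * card Q"
    using card_uniform_partition fU assms(5) by blast
  then have "card (V - \<Union>Q) = r * (n - card Q)"
    using assms fU by (simp add: card_Diff_subset diff_mult_distrib2)
  then show ?thesis
    using bij_betw_same_card[OF bij_betw_matchings_superset[OF assms(4,5,6,1)]] card_matchings assms(1,2)
    by (metis finite_Diff)
qed

text \<open>The probability that \<open>s\<close> given pairwise disjoint \<open>r\<close>-sets are edges of a random matching
  with \<open>n\<close> edges; only meaningful for \<open>s \<le> n\<close>, because of the truncated \<open>n - i\<close>.\<close>

definition edge_prob :: "nat \<Rightarrow> nat \<Rightarrow> nat \<Rightarrow> real" where
  "edge_prob r n s = (\<Prod>i<s. 1 / real ((r * (n - i) - 1) choose (r - 1)))"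

lemma edge_prob_nonneg: "edge_prob r n s \<ge> 0"
  unfolding edge_prob_def by (intro prod_nonneg) auto

lemma edge_prob_eq:
  assumes "r > 0" "s \<le> n"
  shows "real (matching_count r (n - s)) = edge_prob r n s * real (matching_count r n)"
  using assms(2)
proof (induction s)
  case 0
  show ?case by (simp add: edge_prob_def)
next
  case (Suc s)
  have "n - s = Suc (n - Suc s)" using Suc.prems by simp
  then have "matching_count r (n - s) = ((r * (n - s) - 1) choose (r - 1)) * matching_count r (n - Suc s)"
    by (simp add: matching_count_def)
  moreover have "((r * (n - s) - 1) choose (r - 1)) > 0"
    using Suc.prems assms by (auto simp: zero_less_binomial_iff intro!: diff_le_mono)
  ultimately show ?case using Suc
    by (simp add: edge_prob_def field_simps)
qed

section \<open>Uniqueness of cliques and the union bound\<close>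

lemma card_less_inj:
  fixes X :: "'a::linorder set"
  assumes "finite X" "x \<in> X" "y \<in> X" "card {z \<in> X. z < x} = card {z \<in> X. z < y}"
  shows "x = y"
proof (rule ccontr)
  have *: "card {z \<in> X. z < u} < card {z \<in> X. z < v}" if "u \<in> X" "v \<in> X" "u < v" for u v
    using that assms(1) by (intro psubset_card_mono psubsetI) auto
  assume "x \<noteq> y"
  then show False using *[of x y] *[of y x] assms by (cases x y rule: linorder_cases) auto
qed

lemma is_clique_subset: "is_clique r P K \<Longrightarrow> L \<subseteq> K \<Longrightarrow> is_clique r P L"
  unfolding is_clique_def disjoint_def by (meson finite_subset subsetD)

text \<open>A pattern does not tell its two letters apart, but the edge containing the minimum must
  play the letter that opens the word. Order isomorphisms preserve the number of smaller elements in
  each edge, so \<open>S\<close> can be read off \<open>P\<close> alone. Recording the pairs as a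
  set loses nothing, since the first component determines the element of \<open>e\<close>.\<close>

lemma pattern_profile_exists:
  assumes "is_pattern r P" "r > 0"
  shows "\<exists>S. \<forall>e f. finite (e \<union> f) \<longrightarrow> e \<inter> f = {} \<longrightarrow> Min (e \<union> f) \<in> e \<longrightarrow> forms_pattern P e f \<longrightarrow>
    (\<lambda>x. (card {y \<in> e. y < x}, card {y \<in> f. y < x})) ` e = S"
proof -
  have P: "partition_on {1..r * 2} P" "card P = 2"
    using assms by (auto simp: is_pattern_def ordered_matchings_def)
  have UP: "\<Union>P = {1..r * 2}" and dP: "disjoint P" using P by (auto simp: partition_on_def)
  have "Min (\<Union>P) \<in> \<Union>P" using assms(2) unfolding UP by (intro Min_in) auto
  then obtain A where A: "A \<in> P" "Min (\<Union>P) \<in> A" by blast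
  define S where "S = (\<lambda>x. (card {y \<in> A. y < x}, card {y \<in> \<Union>P - A. y < x})) ` A"
  show ?thesis
  proof (intro exI allI impI)
    fix e f :: "nat set"
    assume fin: "finite (e \<union> f)" and dj: "e \<inter> f = {}" and mn: "Min (e \<union> f) \<in> e" and fp: "forms_pattern P e f"
    then obtain \<phi> where \<phi>: "bij_betw \<phi> (e \<union> f) (\<Union>P)" "strict_mono_on (e \<union> f) \<phi>" "{\<phi> ` e, \<phi> ` f} = P"
      by (auto simp: forms_pattern_def order_isomorphic_def)
    have lt: "\<phi> x < \<phi> y \<longleftrightarrow> x < y" if "x \<in> e \<union> f" "y \<in> e \<union> f" for x y
      using strict_mono_on_less[OF \<phi>(2)] that by blast
    have im: "\<phi> ` (e \<union> f) = \<Union>P" and inj: "inj_on \<phi> (e \<union> f)" using \<phi>(1) by (auto simp: bij_betw_def)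
    have "Min (\<Union>P) = \<phi> (Min (e \<union> f))"
    proof (rule Min_eqI)
      show "finite (\<Union>P)" by (simp add: UP)
      show "\<phi> (Min (e \<union> f)) \<in> \<Union>P" using mn im by blast
      fix y assume "y \<in> \<Union>P"
      then obtain x where x: "x \<in> e \<union> f" "y = \<phi> x" using im by blast
      have "Min (e \<union> f) \<le> x" using x fin by simp
      moreover have "Min (e \<union> f) \<in> e \<union> f" using mn by blast
      ultimately show "\<phi> (Min (e \<union> f)) \<le> y"
        using x lt[of x "Min (e \<union> f)"] by (meson leD leI)
    qed
    then have "Min (\<Union>P) \<in> \<phi> ` e" using mn by blast
    then have eA: "\<phi> ` e = A"
      using disjointD[OF dP, of "\<phi> ` e" A] A \<phi>(3) by blast
    have "\<phi> ` f = \<phi> ` ((e \<union> f) - e)" using dj by (intro arg_cong[of _ _ "image \<phi>"]) auto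
    also have "\<dots> = \<Union>P - A"
      using inj_on_image_set_diff[OF inj, of "e \<union> f" e] im eA by auto
    finally have fB: "\<phi> ` f = \<Union>P - A" .
    have c: "card {y \<in> \<phi> ` g. y < \<phi> x} = card {y \<in> g. y < x}" if "g \<subseteq> e \<union> f" "x \<in> e" for g x
    proof -
      have "{y \<in> \<phi> ` g. y < \<phi> x} = \<phi> ` {y \<in> g. y < x}"
        using that lt by (auto 4 3)
      moreover have "inj_on \<phi> {y \<in> g. y < x}" using inj that by (auto intro: inj_on_subset)
      ultimately show ?thesis by (simp add: card_image)
    qed
    show "(\<lambda>x. (card {y \<in> e. y < x}, card {y \<in> f. y < x})) ` e = S"
      unfolding S_def eA[symmetric] fB[unfolded eA[symmetric], symmetric] image_image
      by (intro image_cong) (simp_all add: c)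
  qed
qed

lemma clique_partition_on:
  assumes "is_clique r P K" "r > 0"
  shows "partition_on (\<Union>K) K" "finite (\<Union>K)" "card (\<Union>K) = r * card K"
proof -
  show p: "partition_on (\<Union>K) K" using assms by (auto simp: is_clique_def partition_on_def)
  show f: "finite (\<Union>K)"
    using assms unfolding is_clique_def by (metis card_ge_0_finite finite_Union)
  show "card (\<Union>K) = r * card K"
    using card_uniform_partition[OF f p] assms by (auto simp: is_clique_def)
qed

text \<open>The rank in \<open>\<Union>K\<close> of an element of the first edge is its rank \<open>i\<close> in that edge plus
  \<open>card K - 1\<close> times the number \<open>b\<close> of smaller elements in any other edge, and \<open>b\<close> depends
  only on \<open>i\<close> and the pattern.\<close>

lemma clique_first_edge:
  assumes "is_pattern r P" "r > 0"
  shows "\<exists>S. \<forall>K e. is_clique r P K \<longrightarrow> card K \<ge> 2 \<longrightarrow> e \<in> K \<longrightarrow> Min (\<Union>K) \<in> e \<longrightarrow>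
    e = {w \<in> \<Union>K. card {y \<in> \<Union>K. y < w} \<in> (\<lambda>(i, b). i + (card K - 1) * b) ` S}"
proof -
  obtain S where S: "\<And>e f. finite (e \<union> f) \<Longrightarrow> e \<inter> f = {} \<Longrightarrow> Min (e \<union> f) \<in> e \<Longrightarrow> forms_pattern P e f \<Longrightarrow>
    (\<lambda>x. (card {y \<in> e. y < x}, card {y \<in> f. y < x})) ` e = S"
    using pattern_profile_exists[OF assms] by blast
  show ?thesis
  proof (intro exI allI impI)
    fix K e assume K: "is_clique r P K" and c2: "card K \<ge> 2" and e: "e \<in> K" "Min (\<Union>K) \<in> e"
    note part = clique_partition_on[OF K assms(2)]
    have fK: "finite K" using K by (simp add: is_clique_def)
    have dK: "disjoint K" using K by (simp add: is_clique_def)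
    have prof: "(\<lambda>x. (card {y \<in> e. y < x}, card {y \<in> f. y < x})) ` e = S" if f: "f \<in> K" "f \<noteq> e" for f
    proof (rule S)
      have sub: "e \<union> f \<subseteq> \<Union>K" using e f by blast
      then show fin: "finite (e \<union> f)" using part(2) finite_subset by blast
      show "e \<inter> f = {}" using disjointD[OF dK e(1) f(1)] f by blast
      have "Min (e \<union> f) = Min (\<Union>K)"
        using sub e by (intro Min_eqI[OF fin]) (auto intro: Min_le[OF part(2)])
      then show "Min (e \<union> f) \<in> e" using e by simp
      show "forms_pattern P e f" using K e f by (auto simp: is_clique_def)
    qed
    have "card (K - {e}) > 0" using c2 e fK by simp
    then obtain f0 where f0: "f0 \<in> K" "f0 \<noteq> e" by (auto simp: card_gt_0_iff)
    have fe: "finite e" using part(2) e(1) by (meson Sup_upper finite_subset)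
    have rank: "card {y \<in> \<Union>K. y < x} = card {y \<in> e. y < x} + (card K - 1) * card {y \<in> f0. y < x}"
      if x: "x \<in> e" for x
    proof -
      \<comment> \<open>Both profiles equal \<open>S\<close>, so the pair of \<open>x\<close> for
        one edge occurs in the profile for the other. Its first component is the rank of
        \<open>x\<close> in \<open>e\<close>, hence it occurs there at \<open>x\<close>
        itself.\<close>
      have same: "card {y \<in> f. y < x} = card {y \<in> f0. y < x}" if f: "f \<in> K - {e}" for f
      proof -
        have "(card {y \<in> e. y < x}, card {y \<in> f. y < x}) \<in> (\<lambda>x. (card {y \<in> e. y < x}, card {y \<in> f0. y < x})) ` e"
          using prof[of f] prof[OF f0] f x by blast
        then obtain x' where "x' \<in> e" "card {y \<in> e. y < x} = card {y \<in> e. y < x'}"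
            "card {y \<in> f. y < x} = card {y \<in> f0. y < x'}" by auto
        then show ?thesis using card_less_inj[OF fe x] by metis
      qed
      have "{y \<in> \<Union>K. y < x} = (\<Union>g\<in>K. {y \<in> g. y < x})" by blast
      then have "card {y \<in> \<Union>K. y < x} = card (\<Union>g\<in>K. {y \<in> g. y < x})" by simp
      also have "\<dots> = (\<Sum>g\<in>K. card {y \<in> g. y < x})"
        using fK part(2) dK by (intro card_UN_disjoint) (auto simp: disjoint_def intro: finite_subset[of _ "{..<x}"])
      also have "\<dots> = card {y \<in> e. y < x} + (\<Sum>g\<in>K-{e}. card {y \<in> g. y < x})"
        using fK e(1) by (rule sum.remove)
      also have "(\<Sum>g\<in>K-{e}. card {y \<in> g. y < x}) = (card K - 1) * card {y \<in> f0. y < x}"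
        using same e(1) by (simp add: card_Diff_singleton)
      finally show ?thesis .
    qed
    have R: "(\<lambda>(i, b). i + (card K - 1) * b) ` S = (\<lambda>x. card {y \<in> \<Union>K. y < x}) ` e"
      unfolding prof[OF f0, symmetric] image_image using rank by (intro image_cong) auto
    show "e = {w \<in> \<Union>K. card {y \<in> \<Union>K. y < w} \<in> (\<lambda>(i, b). i + (card K - 1) * b) ` S}"
      unfolding R
    proof (intro equalityI subsetI)
      fix w assume "w \<in> {w \<in> \<Union>K. card {y \<in> \<Union>K. y < w} \<in> (\<lambda>x. card {y \<in> \<Union>K. y < x}) ` e}"
      then obtain x where "x \<in> e" "w \<in> \<Union>K" "card {y \<in> \<Union>K. y < w} = card {y \<in> \<Union>K. y < x}" by auto
      moreover from this have "x \<in> \<Union>K" using e by blast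
      ultimately show "w \<in> e" using card_less_inj[OF part(2)] by blast
    qed (use e in auto)
  qed
qed

text \<open>Induction peels off the edge holding the minimum. Its ranks depend on the number of
  edges as well as on the pattern, so equality of the cardinalities is needed first; it comes from
  counting vertices.\<close>

lemma clique_unique:
  assumes "is_pattern r P" "r > 0" "is_clique r P K" "is_clique r P L" "\<Union>K = \<Union>L"
  shows "K = L"
proof -
  obtain S where S: "\<And>K e. is_clique r P K \<Longrightarrow> card K \<ge> 2 \<Longrightarrow> e \<in> K \<Longrightarrow> Min (\<Union>K) \<in> e \<Longrightarrow>
    e = {w \<in> \<Union>K. card {y \<in> \<Union>K. y < w} \<in> (\<lambda>(i, b). i + (card K - 1) * b) ` S}"
    using clique_first_edge[OF assms(1,2)] by blast
  have "card K = card L"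
    using clique_partition_on(3)[OF assms(3,2)] clique_partition_on(3)[OF assms(4,2)] assms by simp
  then show ?thesis using assms(3-5)
  proof (induction "card K" arbitrary: K L)
    case 0
    then show ?case by (auto simp: is_clique_def)
  next
    case (Suc k)
    have fK: "finite K" "finite L" using Suc.prems by (auto simp: is_clique_def)
    show ?case
    \<comment> \<open>The rank formula compares the first edge with a second one, so a single edge
      is treated separately.\<close>
    proof (cases "card K = 1")
      case True
      then obtain e f where "K = {e}" "L = {f}" using Suc.prems(1) by (metis card_1_singletonE)
      then show ?thesis using Suc.prems by simp
    next
      case False
      then have c2: "card K \<ge> 2" "card L \<ge> 2" using Suc by linarith+
      have "\<Union>K \<noteq> {}"
        using clique_partition_on(3)[OF Suc.prems(2) assms(2)] c2 assms(2) by force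
      then have "Min (\<Union>K) \<in> \<Union>K" using clique_partition_on(2)[OF Suc.prems(2) assms(2)] by (intro Min_in)
      moreover from this have "Min (\<Union>L) \<in> \<Union>L" using Suc.prems(4) by simp
      ultimately obtain e f where e: "e \<in> K" "Min (\<Union>K) \<in> e" and f: "f \<in> L" "Min (\<Union>L) \<in> f" by blast
      have ef: "e = f"
        using S[OF Suc.prems(2) c2(1) e] S[OF Suc.prems(3) c2(2) f] Suc.prems(1,4) by simp
      have U: "\<Union>(M - {g}) = \<Union>M - g" if "is_clique r P M" "g \<in> M" for M g
        using that by (auto simp: is_clique_def disjoint_def)
      have "K - {e} = L - {f}"
      proof (rule Suc.hyps(1))
        show "k = card (K - {e})" using Suc.hyps(2) e fK by simp
        show "card (K - {e}) = card (L - {f})" using Suc.prems(1) e f fK by simp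
        show "is_clique r P (K - {e})" "is_clique r P (L - {f})"
          using Suc.prems is_clique_subset by blast+
        show "\<Union>(K - {e}) = \<Union>(L - {f})"
          using U[OF Suc.prems(2) e(1)] U[OF Suc.prems(3) f(1)] Suc.prems(4) ef by simp
      qed
      then show ?thesis using e f ef by blast
    qed
  qed
qed

text \<open>The union ranges over vertex sets, not over cliques: by uniqueness each \<open>W\<close>
  leaves at most one set of \<open>k\<close> edges that the matching could contain.\<close>

lemma card_matchings_with_clique_le:
  assumes "is_pattern r P" "r > 0" "finite V" "card V = r * n"
  shows "card {M \<in> matchings r V. \<exists>K\<subseteq>M. is_clique r P K \<and> card K = k}
    \<le> ((r * n) choose (r * k)) * matching_count r (n - k)"
proof -
  define \<W> where "\<W> = {W. W \<subseteq> V \<and> card W = r * k}"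
  define C where "C W = {M \<in> matchings r V. \<exists>K\<subseteq>M. is_clique r P K \<and> card K = k \<and> \<Union>K = W}" for W
  have f\<W>: "finite \<W>" using assms(3) by (simp add: \<W>_def)
  have "{M \<in> matchings r V. \<exists>K\<subseteq>M. is_clique r P K \<and> card K = k} \<subseteq> (\<Union>W\<in>\<W>. C W)"
  proof
    fix M assume "M \<in> {M \<in> matchings r V. \<exists>K\<subseteq>M. is_clique r P K \<and> card K = k}"
    then obtain K where K: "M \<in> matchings r V" "K \<subseteq> M" "is_clique r P K" "card K = k" by auto
    then have "\<Union>K \<in> \<W>"
      using clique_partition_on(3)[OF K(3) assms(2)] by (auto simp: \<W>_def matchings_def partition_on_def)
    then show "M \<in> (\<Union>W\<in>\<W>. C W)" using K by (auto simp: C_def)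
  qed
  moreover have "finite (C W)" for W
    using finite_matchings[OF assms(3)] by (simp add: C_def)
  ultimately have "card {M \<in> matchings r V. \<exists>K\<subseteq>M. is_clique r P K \<and> card K = k} \<le> card (\<Union>W\<in>\<W>. C W)"
    using f\<W> by (intro card_mono) auto
  also have "\<dots> \<le> (\<Sum>W\<in>\<W>. card (C W))" using f\<W> by (rule card_UN_le)
  also have "\<dots> \<le> (\<Sum>W\<in>\<W>. matching_count r (n - k))"
  proof (rule sum_mono)
    fix W assume W: "W \<in> \<W>"
    show "card (C W) \<le> matching_count r (n - k)"
    proof (cases "\<exists>K. is_clique r P K \<and> card K = k \<and> \<Union>K = W")
      case False
      then have "C W = {}" unfolding C_def by blast
      then show ?thesis by simp
    next
      case True
      then obtain K where K: "is_clique r P K" "card K = k" "\<Union>K = W" by blast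
      have "C W \<subseteq> {M \<in> matchings r V. K \<subseteq> M}"
      proof
        fix M assume "M \<in> C W"
        then obtain L where "M \<in> matchings r V" "L \<subseteq> M" "is_clique r P L" "\<Union>L = W" by (auto simp: C_def)
        then show "M \<in> {M \<in> matchings r V. K \<subseteq> M}"
          using clique_unique[OF assms(1,2) K(1), of L] K(3) by simp
      qed
      then have "card (C W) \<le> card {M \<in> matchings r V. K \<subseteq> M}"
        using finite_matchings[OF assms(3)] by (intro card_mono) auto
      also have "\<dots> = matching_count r (n - k)"
        using card_matchings_superset[OF assms(2-4), of K] K W by (auto simp: is_clique_def \<W>_def)
      finally show ?thesis .
    qed
  qed
  also have "\<dots> = ((r * n) choose (r * k)) * matching_count r (n - k)"
    using n_subsets[OF assms(3), of "r * k"] assms(4) by (simp add: \<W>_def)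
  finally show ?thesis .
qed

text \<open>Passing from k to k + 1 multiplies the left side by exactly (n - k) / ((r k + r) choose
  r), which is at most n / (k + 1)^r.\<close>

lemma binomial_edge_prob_le:
  assumes "r > 0" "k \<le> n"
  shows "real ((r * n) choose (r * k)) * edge_prob r n k \<le> real n ^ k / fact k ^ r"
  using assms(2)
proof (induction k)
  case 0
  then show ?case by (simp add: edge_prob_def)
next
  case (Suc k)
  define b where "b = (r * (n - k) - 1) choose (r - 1)"
  have b: "b > 0"
    using Suc.prems assms by (auto simp: b_def zero_less_binomial_iff intro!: diff_le_mono)
  \<comment> \<open>Choosing r k + r vertices and then r k of them amounts to choosing r k vertices
    and then r of the others.\<close>
  have "((r * n) choose (r * k + r)) * ((r * k + r) choose (r * k)) = ((r * n) choose (r * k)) * ((r * n - r * k) choose r)"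
    using choose_mult[of "r * k" "r * k + r" "r * n"] mult_le_mono2[OF Suc.prems, of r] by simp
  moreover have "(r * k + r) choose (r * k) = (r * k + r) choose r"
    by (subst binomial_symmetric) auto
  \<comment> \<open>Absorption: with N = r (n - k), r times (N choose r) equals N times ((N - 1)
    choose (r - 1)).\<close>
  moreover have "(r * n - r * k) choose r = (n - k) * b"
  proof -
    have "r * ((r * (n - k)) choose r) = r * ((n - k) * b)"
      using times_binomial_minus1_eq[OF assms(1), of "r * (n - k)"] by (auto simp: b_def)
    then have "(r * (n - k)) choose r = (n - k) * b" using assms(1) nat_mult_eq_cancel1 by blast
    then show ?thesis by (simp add: diff_mult_distrib2)
  qed
  ultimately have eq: "((r * n) choose (r * Suc k)) * ((r * k + r) choose r) = ((r * n) choose (r * k)) * ((n - k) * b)"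
    by (simp add: add.commute)
  have "(real (r * k + r) / real r) ^ r \<le> real ((r * k + r) choose r)"
    by (rule binomial_ge_n_over_k_pow_k) simp
  moreover have "real (r * k + r) / real r = real (Suc k)" using assms(1) by (simp add: field_simps)
  ultimately have ge: "real (Suc k) ^ r \<le> real ((r * k + r) choose r)" by metis
  have "real ((r * n) choose (r * Suc k)) * edge_prob r n (Suc k) * real (Suc k) ^ r
      = real ((r * n) choose (r * Suc k)) * real (Suc k) ^ r * edge_prob r n k / b"
    by (simp add: edge_prob_def b_def)
  also have "\<dots> \<le> real ((r * n) choose (r * Suc k)) * real ((r * k + r) choose r) * edge_prob r n k / b"
    using ge edge_prob_nonneg[of r n k] by (intro divide_right_mono mult_right_mono mult_left_mono) auto
  also have "\<dots> = real (((r * n) choose (r * k)) * ((n - k) * b)) * edge_prob r n k / b"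
    using eq by (metis of_nat_mult)
  also have "\<dots> = real (n - k) * (real ((r * n) choose (r * k)) * edge_prob r n k)"
    using b by simp
  also have "\<dots> \<le> real n * (real n ^ k / fact k ^ r)"
    using Suc edge_prob_nonneg[of r n k] by (intro mult_mono) auto
  finally have "real ((r * n) choose (r * Suc k)) * edge_prob r n (Suc k) \<le> real n * (real n ^ k / fact k ^ r) / real (Suc k) ^ r"
    by (subst pos_le_divide_eq) auto
  also have "\<dots> = real n ^ Suc k / fact (Suc k) ^ r"
    by (simp only: fact_Suc power_mult_distrib power_Suc) simp
  finally show ?case .
qed

section \<open>Blowing up a template clique\<close>

lemma order_isomorphic_sym:
  assumes "order_isomorphic M N"
  shows "order_isomorphic N M"
proof -
  obtain \<phi> where \<phi>: "bij_betw \<phi> (\<Union>M) (\<Union>N)" "strict_mono_on (\<Union>M) \<phi>" "(`) \<phi> ` M = N"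
    using assms by (auto simp: order_isomorphic_def)
  have inj: "inj_on \<phi> (\<Union>M)" and im: "\<phi> ` \<Union>M = \<Union>N" using \<phi>(1) by (auto simp: bij_betw_def)
  define \<psi> where "\<psi> = inv_into (\<Union>M) \<phi>"
  have "bij_betw \<psi> (\<Union>N) (\<Union>M)" unfolding \<psi>_def by (rule bij_betw_inv_into[OF \<phi>(1)])
  moreover have "strict_mono_on (\<Union>N) \<psi>"
  proof (rule strict_mono_onI)
    fix x y assume xy: "x \<in> \<Union>N" "y \<in> \<Union>N" "x < y"
    then have "\<psi> x \<in> \<Union>M" "\<psi> y \<in> \<Union>M" "\<phi> (\<psi> x) = x" "\<phi> (\<psi> y) = y"
      unfolding \<psi>_def im[symmetric] by (blast intro: inv_into_into f_inv_into_f)+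
    then show "\<psi> x < \<psi> y" using strict_mono_on_less[OF \<phi>(2)] xy(3) by metis
  qed
  moreover have "\<psi> ` \<phi> ` e = e" if "e \<in> M" for e
    unfolding \<psi>_def using that by (intro inv_into_image_cancel[OF inj]) auto
  then have "(`) \<psi> ` N = M" unfolding \<phi>(3)[symmetric] image_image by simp
  ultimately show ?thesis unfolding order_isomorphic_def by blast
qed

lemma order_isomorphic_trans:
  assumes "order_isomorphic M N" "order_isomorphic N R"
  shows "order_isomorphic M R"
proof -
  obtain \<phi> where \<phi>: "bij_betw \<phi> (\<Union>M) (\<Union>N)" "strict_mono_on (\<Union>M) \<phi>" "(`) \<phi> ` M = N"
    using assms by (auto simp: order_isomorphic_def)
  obtain \<psi> where \<psi>: "bij_betw \<psi> (\<Union>N) (\<Union>R)" "strict_mono_on (\<Union>N) \<psi>" "(`) \<psi> ` N = R"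
    using assms by (auto simp: order_isomorphic_def)
  have im: "\<phi> ` \<Union>M = \<Union>N" using \<phi>(1) by (auto simp: bij_betw_def)
  have "strict_mono_on (\<Union>M) (\<psi> \<circ> \<phi>)"
  proof (rule strict_mono_onI)
    fix x y assume xy: "x \<in> \<Union>M" "y \<in> \<Union>M" "x < y"
    then have "\<phi> x \<in> \<Union>N" "\<phi> y \<in> \<Union>N" "\<phi> x < \<phi> y"
      using im strict_mono_onD[OF \<phi>(2)] by blast+
    then show "(\<psi> \<circ> \<phi>) x < (\<psi> \<circ> \<phi>) y" using strict_mono_onD[OF \<psi>(2)] by simp
  qed
  moreover have "bij_betw (\<psi> \<circ> \<phi>) (\<Union>M) (\<Union>R)" using \<phi>(1) \<psi>(1) by (rule bij_betw_trans)
  moreover have "(`) (\<psi> \<circ> \<phi>) ` M = R"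
    unfolding \<psi>(3)[symmetric] \<phi>(3)[symmetric] by (simp add: image_image image_comp)
  ultimately show ?thesis unfolding order_isomorphic_def by blast
qed

text \<open>Blocks are numbered from 0 while vertices start at 1, hence the offset in the
  intervals.\<close>

definition transversals :: "nat \<Rightarrow> nat set \<Rightarrow> nat set set" where
  "transversals L J = (\<lambda>g. g ` J) ` (\<Pi>\<^sub>E j\<in>J. {j * L + 1..j * L + L})"

definition block_index :: "nat \<Rightarrow> nat \<Rightarrow> nat" where
  "block_index L x = (x - 1) div L"

lemma block_index_PiE:
  assumes "g \<in> (\<Pi>\<^sub>E j\<in>J. {j * L + 1..j * L + L})" "j \<in> J"
  shows "block_index L (g j) = j"
proof -
  have "g j \<in> {j * L + 1..j * L + L}" using assms by auto
  then have "j * L \<le> g j - 1" "g j - 1 < j * L + L" by auto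
  then show ?thesis unfolding block_index_def
    by (intro div_nat_eqI) (auto simp: mult.commute)
qed

lemma transversal_bij:
  assumes "f \<in> transversals L J"
  shows "bij_betw (block_index L) f J"
proof -
  obtain g where g: "f = g ` J" "g \<in> (\<Pi>\<^sub>E j\<in>J. {j * L + 1..j * L + L})"
    using assms by (auto simp: transversals_def)
  show ?thesis
    by (rule bij_betw_byWitness[where f' = g]) (use block_index_PiE[OF g(2)] g(1) in auto)
qed

lemma card_transversals:
  assumes "finite J"
  shows "card (transversals L J) = L ^ card J"
proof -
  have "inj_on (\<lambda>g. g ` J) (\<Pi>\<^sub>E j\<in>J. {j * L + 1..j * L + L})"
  proof (rule inj_onI)
    fix g h assume g: "g \<in> (\<Pi>\<^sub>E j\<in>J. {j * L + 1..j * L + L})"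
      and h: "h \<in> (\<Pi>\<^sub>E j\<in>J. {j * L + 1..j * L + L})" and eq: "g ` J = h ` J"
    show "g = h"
    proof (rule PiE_ext[OF g h])
      fix j assume j: "j \<in> J"
      then obtain i where "i \<in> J" "g j = h i" using eq by blast
      then show "g j = h j" using block_index_PiE[OF g j] block_index_PiE[OF h] by metis
    qed
  qed
  then show ?thesis
    using assms by (simp add: transversals_def card_image card_PiE)
qed

lemma transversal_subset:
  assumes "f \<in> transversals L J" "J \<subseteq> {..<N}"
  shows "f \<subseteq> {1..N * L}"
proof
  fix x assume "x \<in> f"
  then obtain j where j: "j \<in> J" "x \<in> {j * L + 1..j * L + L}"
    using assms(1) by (auto simp: transversals_def PiE_def Pi_def)
  have "Suc j \<le> N" using j assms(2) by auto
  then have "Suc j * L \<le> N * L" by (rule mult_le_mono1)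
  then show "x \<in> {1..N * L}" using j(2) by auto
qed

lemma transversals_disjoint:
  assumes "f \<in> transversals L J" "f' \<in> transversals L J'" "J \<inter> J' = {}"
  shows "f \<inter> f' = {}"
  using transversal_bij[OF assms(1)] transversal_bij[OF assms(2)] assms(3)
  by (fastforce simp: bij_betw_def)

text \<open>\<open>block_index\<close> is monotone on all numbers. On the union of the two
  transversals it is also injective, since every block involved is hit once, so it is itself the
  order isomorphism onto the two index sets.\<close>

lemma order_isomorphic_transversals:
  assumes f: "f \<in> transversals L J" and f': "f' \<in> transversals L J'" and J: "J \<inter> J' = {}"
  shows "order_isomorphic {f, f'} {J, J'}"
  unfolding order_isomorphic_def
proof (intro exI conjI)
  have b: "bij_betw (block_index L) f J" "bij_betw (block_index L) f' J'"
    using transversal_bij f f' by auto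
  have bij: "bij_betw (block_index L) (f \<union> f') (J \<union> J')"
    using b J by (rule bij_betw_combine)
  then show "bij_betw (block_index L) (\<Union>{f, f'}) (\<Union>{J, J'})" by simp
  show "strict_mono_on (\<Union>{f, f'}) (block_index L)"
  proof (rule strict_mono_onI)
    fix x y assume xy: "x \<in> \<Union>{f, f'}" "y \<in> \<Union>{f, f'}" "x < y"
    then have "block_index L x \<noteq> block_index L y"
      using bij by (auto simp: bij_betw_def inj_on_def)
    moreover have "block_index L x \<le> block_index L y"
      unfolding block_index_def using xy(3) by (intro div_le_mono) auto
    ultimately show "block_index L x < block_index L y" by simp
  qed
  show "(`) (block_index L) ` {f, f'} = {J, J'}" using b by (auto simp: bij_betw_def)
qed

text \<open>Ranks count from 0 to agree with the numbering of the blocks; they move a template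
  clique on arbitrary vertices onto an initial segment.\<close>

definition position :: "nat set set \<Rightarrow> nat \<Rightarrow> nat" where
  "position K v = card {u \<in> \<Union>K. u < v}"

lemma position_strict_mono:
  assumes "finite (\<Union>K)"
  shows "strict_mono_on (\<Union>K) (position K)"
proof (rule strict_mono_onI)
  fix x y assume "x \<in> \<Union>K" "y \<in> \<Union>K" "x < y"
  then show "position K x < position K y"
    unfolding position_def using assms by (intro psubset_card_mono psubsetI) auto
qed

lemma position_less:
  assumes "finite (\<Union>K)" "v \<in> \<Union>K"
  shows "position K v < card (\<Union>K)"
  unfolding position_def using assms by (intro psubset_card_mono psubsetI) auto

text \<open>Stated for subfamilies \<open>H\<close>, because a matching may miss some template
  edges. A pair of transversals is compared with its pair of index sets, these with the template
  edges, and these with \<open>P\<close>.\<close>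

lemma clique_of_transversals:
  assumes K: "is_clique r P K" "r > 0" "H \<subseteq> K"
    and F: "\<And>a. a \<in> H \<Longrightarrow> F a \<in> transversals L (position K ` a)"
  shows "is_clique r P (F ` H)" "card (F ` H) = card H"
proof -
  have fK: "finite K" and dK: "disjoint K" and cK: "\<And>e. e \<in> K \<Longrightarrow> card e = r"
    using K by (auto simp: is_clique_def)
  have fU: "finite (\<Union>K)" using K fK cK by (metis card_ge_0_finite finite_Union)
  have mono: "strict_mono_on (\<Union>K) (position K)" using position_strict_mono[OF fU] .
  have inj: "inj_on (position K) (\<Union>K)" using mono by (rule strict_mono_on_imp_inj_on)
  have cF: "card (F a) = r" if "a \<in> H" for a
  proof -
    have "card (F a) = card (position K ` a)" using transversal_bij[OF F[OF that]] by (rule bij_betw_same_card)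
    also have "\<dots> = card a" using inj that K(3) by (intro card_image) (auto intro: inj_on_subset)
    finally show ?thesis using cK that K(3) by auto
  qed
  have disj: "position K ` a \<inter> position K ` b = {}" if "a \<in> H" "b \<in> H" "a \<noteq> b" for a b
  proof -
    have "a \<inter> b = {}" using that dK K(3) by (auto simp: disjoint_def)
    moreover have "position K ` a \<inter> position K ` b = position K ` (a \<inter> b)"
      using that K(3) by (intro inj_on_image_Int[OF inj, symmetric]) auto
    ultimately show ?thesis by simp
  qed
  have dF: "F a \<inter> F b = {}" if "a \<in> H" "b \<in> H" "a \<noteq> b" for a b
    using transversals_disjoint[OF F[OF that(1)] F[OF that(2)] disj[OF that]] .
  have "F a \<noteq> F b" if "a \<in> H" "b \<in> H" "a \<noteq> b" for a b
    using dF[OF that] cF[OF that(1)] K(2) by force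
  then have "inj_on F H" by (auto simp: inj_on_def)
  then show "card (F ` H) = card H" by (rule card_image)
  have "order_isomorphic {F a, F b} P" if ab: "a \<in> H" "b \<in> H" "F a \<noteq> F b" for a b
  proof -
    have ne: "a \<noteq> b" using ab by auto
    have "order_isomorphic {F a, F b} {position K ` a, position K ` b}"
      using order_isomorphic_transversals[OF F[OF ab(1)] F[OF ab(2)] disj[OF ab(1,2) ne]] .
    moreover have "order_isomorphic {a, b} {position K ` a, position K ` b}"
      unfolding order_isomorphic_def
    proof (intro exI conjI)
      have sub: "\<Union>{a, b} \<subseteq> \<Union>K" using ab K(3) by auto
      show "strict_mono_on (\<Union>{a, b}) (position K)"
        using mono sub by (rule monotone_on_subset)
      show "bij_betw (position K) (\<Union>{a, b}) (\<Union>{position K ` a, position K ` b})"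
        using inj_on_subset[OF inj sub] by (auto simp: bij_betw_def)
      show "(`) (position K) ` {a, b} = {position K ` a, position K ` b}" by simp
    qed
    moreover have "order_isomorphic {a, b} P"
      using K(1) subsetD[OF K(3) ab(1)] subsetD[OF K(3) ab(2)] ne
      unfolding is_clique_def forms_pattern_def by blast
    ultimately show ?thesis using order_isomorphic_sym order_isomorphic_trans by blast
  qed
  moreover have "disjoint (F ` H)" unfolding disjoint_def using dF by blast
  ultimately show "is_clique r P (F ` H)"
    using finite_subset[OF K(3) fK] cF unfolding is_clique_def forms_pattern_def by blast
qed

section \<open>Binomial moments of the number of edges taken from a given family\<close>

definition submatchings :: "nat \<Rightarrow> 'a set set \<Rightarrow> 'a set set set" where
  "submatchings s T = {Q. Q \<subseteq> T \<and> card Q = s \<and> disjoint Q}"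

lemma finite_submatchings: "finite T \<Longrightarrow> finite (submatchings s T)"
  by (rule finite_subset[of _ "Pow T"]) (auto simp: submatchings_def)

lemma card_submatchings_le: "finite T \<Longrightarrow> card (submatchings s T) \<le> card T choose s"
  unfolding n_subsets[of T s, symmetric]
  by (intro card_mono) (auto simp: submatchings_def intro: finite_subset[of _ "Pow T"])

lemma card_submatchings_1: "card (submatchings 1 T) = card T"
proof -
  have "submatchings 1 T = (\<lambda>e. {e}) ` T"
    by (auto simp: submatchings_def disjoint_def card_1_singleton_iff)
  then show ?thesis by (simp add: card_image)
qed

text \<open>The edges of a matching are pairwise disjoint, so every \<open>s\<close>-subset of
  \<open>T \<inter> M\<close> is already a submatching. Binomials are averaged rather than powers
  because they are plain sums of indicators.\<close>

lemma choose_card_Int_matching: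
  assumes "finite T" "M \<in> matchings r V"
  shows "real (card (T \<inter> M) choose s) = (\<Sum>Q\<in>submatchings s T. of_bool (Q \<subseteq> M))"
proof -
  have "disjoint M" using assms by (auto simp: matchings_def partition_on_def)
  then have "{Q. Q \<subseteq> T \<inter> M \<and> card Q = s} = {Q \<in> submatchings s T. Q \<subseteq> M}"
    by (auto simp: submatchings_def disjoint_def)
  moreover have "card {Q. Q \<subseteq> T \<inter> M \<and> card Q = s} = card (T \<inter> M) choose s"
    using assms by (intro n_subsets) auto
  ultimately show ?thesis
    using finite_submatchings[OF assms(1)]
    by (simp add: of_bool_def sum.If_cases Int_def)
qed

lemma sum_choose_card_Int:
  assumes "r > 0" "finite V" "card V = r * n" "finite T" "\<And>e. e \<in> T \<Longrightarrow> e \<subseteq> V \<and> card e = r"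
  shows "(\<Sum>M\<in>matchings r V. real (card (T \<inter> M) choose s)) =
    real (card (submatchings s T)) * real (matching_count r (n - s))"
proof -
  have fM: "finite (matchings r V)" using finite_matchings assms(2) .
  have "(\<Sum>M\<in>matchings r V. real (card (T \<inter> M) choose s)) =
      (\<Sum>M\<in>matchings r V. \<Sum>Q\<in>submatchings s T. of_bool (Q \<subseteq> M))"
    using choose_card_Int_matching[OF assms(4)] by (intro sum.cong) auto
  also have "\<dots> = (\<Sum>Q\<in>submatchings s T. \<Sum>M\<in>matchings r V. of_bool (Q \<subseteq> M))"
    by (rule sum.swap)
  also have "\<dots> = (\<Sum>Q\<in>submatchings s T. real (matching_count r (n - s)))"
  proof (rule sum.cong)
    fix Q assume Q: "Q \<in> submatchings s T"
    then have "card {M \<in> matchings r V. Q \<subseteq> M} = matching_count r (n - card Q)"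
      using assms(5) by (intro card_matchings_superset[OF assms(1-3)]) (auto simp: submatchings_def)
    then show "(\<Sum>M\<in>matchings r V. of_bool (Q \<subseteq> M)) = real (matching_count r (n - s))"
      using fM Q by (simp add: of_bool_def sum.If_cases Int_def submatchings_def)
  qed simp
  finally show ?thesis by simp
qed

text \<open>No edge of \<open>T\<close> meets an edge of \<open>T'\<close>, so any two submatchings
  combine into one with \<open>2 * s\<close> edges. The joint average is therefore exact, and the
  dependence shows in the argument \<open>n - 2 * s\<close> alone.\<close>

lemma sum_choose_card_Int_mult:
  assumes "r > 0" "finite V" "card V = r * n"
    and T: "finite T" "\<And>e. e \<in> T \<Longrightarrow> e \<subseteq> V \<and> card e = r"
    and T': "finite T'" "\<And>e. e \<in> T' \<Longrightarrow> e \<subseteq> V \<and> card e = r"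
    and dj: "\<And>e f. e \<in> T \<Longrightarrow> f \<in> T' \<Longrightarrow> e \<inter> f = {}"
  shows "(\<Sum>M\<in>matchings r V. real (card (T \<inter> M) choose s) * real (card (T' \<inter> M) choose s)) =
    real (card (submatchings s T)) * real (card (submatchings s T')) * real (matching_count r (n - 2 * s))"
proof -
  have fM: "finite (matchings r V)" using finite_matchings assms(2) .
  have "(\<Sum>M\<in>matchings r V. real (card (T \<inter> M) choose s) * real (card (T' \<inter> M) choose s)) =
      (\<Sum>M\<in>matchings r V. \<Sum>Q\<in>submatchings s T. \<Sum>Q'\<in>submatchings s T'. of_bool (Q \<union> Q' \<subseteq> M))"
    using choose_card_Int_matching[OF T(1)] choose_card_Int_matching[OF T'(1)]
    by (intro sum.cong) (auto simp: sum_product of_bool_conj intro!: sum.cong)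
  also have "\<dots> = (\<Sum>Q\<in>submatchings s T. \<Sum>M\<in>matchings r V. \<Sum>Q'\<in>submatchings s T'. of_bool (Q \<union> Q' \<subseteq> M))"
    by (rule sum.swap)
  also have "\<dots> = (\<Sum>Q\<in>submatchings s T. \<Sum>Q'\<in>submatchings s T'. \<Sum>M\<in>matchings r V. of_bool (Q \<union> Q' \<subseteq> M))"
    by (intro sum.cong refl sum.swap)
  also have "\<dots> = (\<Sum>Q\<in>submatchings s T. \<Sum>Q'\<in>submatchings s T'. real (matching_count r (n - 2 * s)))"
  proof (intro sum.cong refl)
    fix Q Q' assume Q: "Q \<in> submatchings s T" and Q': "Q' \<in> submatchings s T'"
    have X: "e \<inter> f = {}" if "e \<in> Q" "f \<in> Q'" for e f
      using that Q Q' dj by (auto simp: submatchings_def)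
    \<comment> \<open>A common edge would be disjoint from itself, hence empty, contradicting r >
      0.\<close>
    have "Q \<inter> Q' = {}"
    proof (rule equals0I)
      fix e assume "e \<in> Q \<inter> Q'"
      then have "e = {}" "e \<in> T" using X[of e e] Q by (auto simp: submatchings_def)
      then show False using T(2)[of e] assms(1) by simp
    qed
    moreover have "finite Q" "finite Q'" using Q Q' T T' by (auto simp: submatchings_def intro: finite_subset)
    ultimately have "card (Q \<union> Q') = 2 * s"
      using Q Q' by (simp add: card_Un_disjoint submatchings_def)
    moreover have "disjoint (Q \<union> Q')"
      using Q Q' X by (intro disjoint_union) (auto simp: submatchings_def)
    moreover have "e \<subseteq> V \<and> card e = r" if "e \<in> Q \<union> Q'" for e
    proof -
      have "e \<in> T \<or> e \<in> T'" using that Q Q' unfolding submatchings_def by blast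
      then show ?thesis using T(2) T'(2) by blast
    qed
    ultimately have "card {M \<in> matchings r V. Q \<union> Q' \<subseteq> M} = matching_count r (n - 2 * s)"
      using card_matchings_superset[OF assms(1-3), of "Q \<union> Q'"] by (metis Sup_least)
    then show "(\<Sum>M\<in>matchings r V. of_bool (Q \<union> Q' \<subseteq> M)) = real (matching_count r (n - 2 * s))"
      using fM by (simp add: of_bool_def sum.If_cases Int_def)
  qed
  finally show ?thesis by simp
qed

text \<open>Chebyshev's inequality in counting form. \<open>D\<close> bounds the diagonal and
  \<open>\<epsilon>\<close> measures the failure of independence; with m the sum of the means, the
  variance is at most card A * D + \<epsilon> m^2.\<close>

lemma chebyshev_sum_card:
  fixes f :: "'a \<Rightarrow> 'b \<Rightarrow> real"
  assumes S: "finite S" "S \<noteq> {}" and A: "finite A" and \<delta>: "\<delta> > 0" and D: "D \<ge> 0"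
    and mean: "\<And>a. a \<in> A \<Longrightarrow> (\<Sum>M\<in>S. f a M) = real (card S) * \<mu> a"
    and diag: "\<And>a. a \<in> A \<Longrightarrow> (\<Sum>M\<in>S. (f a M)\<^sup>2) \<le> real (card S) * D"
    and off: "\<And>a b. a \<in> A \<Longrightarrow> b \<in> A \<Longrightarrow> a \<noteq> b \<Longrightarrow>
      (\<Sum>M\<in>S. f a M * f b M) \<le> real (card S) * ((1 + \<epsilon>) * (\<mu> a * \<mu> b))"
    and \<epsilon>: "\<epsilon> \<ge> 0"
  shows "real (card {M \<in> S. \<bar>(\<Sum>a\<in>A. f a M) - (\<Sum>a\<in>A. \<mu> a)\<bar> \<ge> \<delta>}) / real (card S)
    \<le> (real (card A) * D + \<epsilon> * (\<Sum>a\<in>A. \<mu> a)\<^sup>2) / \<delta>\<^sup>2"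
proof -
  define N where "N = real (card S)"
  define F where "F M = (\<Sum>a\<in>A. f a M)" for M
  define m where "m = (\<Sum>a\<in>A. \<mu> a)"
  have N: "N > 0" using S by (simp add: N_def card_gt_0_iff)
  have sF: "(\<Sum>M\<in>S. F M) = N * m"
    unfolding F_def m_def by (subst sum.swap) (simp add: mean sum_distrib_left N_def)
  have "(\<Sum>M\<in>S. (F M)\<^sup>2) = (\<Sum>M\<in>S. \<Sum>a\<in>A. \<Sum>b\<in>A. f a M * f b M)"
    by (simp add: F_def power2_eq_square sum_product)
  also have "\<dots> = (\<Sum>a\<in>A. \<Sum>b\<in>A. \<Sum>M\<in>S. f a M * f b M)"
    by (subst sum.swap) (intro sum.cong refl sum.swap)
  \<comment> \<open>Diagonal terms also receive a nonnegative multiple of the squared mean, so that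
    the off-diagonal bounds complete to the full square of m.\<close>
  also have "\<dots> \<le> (\<Sum>a\<in>A. \<Sum>b\<in>A. N * ((if a = b then D else 0) + (1 + \<epsilon>) * (\<mu> a * \<mu> b)))"
  proof (intro sum_mono)
    fix a b assume ab: "a \<in> A" "b \<in> A"
    show "(\<Sum>M\<in>S. f a M * f b M) \<le> N * ((if a = b then D else 0) + (1 + \<epsilon>) * (\<mu> a * \<mu> b))"
    proof (cases "a = b")
      case True
      have "(\<Sum>M\<in>S. f a M * f b M) \<le> N * D"
        using diag[OF ab(1)] True by (simp add: N_def power2_eq_square)
      also have "\<dots> \<le> N * (D + (1 + \<epsilon>) * (\<mu> a * \<mu> b))"
        using True \<epsilon> N by (intro mult_left_mono) auto
      finally show ?thesis using True by simp
    qed (use off[OF ab] in \<open>simp add: N_def\<close>)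
  qed
  also have "\<dots> = N * (real (card A) * D + (1 + \<epsilon>) * m\<^sup>2)"
  proof -
    have "(\<Sum>a\<in>A. \<Sum>b\<in>A. (if a = b then D else 0)) = real (card A) * D"
      using A by simp
    moreover have "(\<Sum>a\<in>A. \<Sum>b\<in>A. (1 + \<epsilon>) * (\<mu> a * \<mu> b)) = (1 + \<epsilon>) * m\<^sup>2"
      by (simp only: sum_distrib_left[symmetric] m_def power2_eq_square sum_product)
    ultimately show ?thesis
      by (simp only: sum_distrib_left[symmetric] sum.distrib)
  qed
  finally have sF2: "(\<Sum>M\<in>S. (F M)\<^sup>2) \<le> N * (real (card A) * D + (1 + \<epsilon>) * m\<^sup>2)" .
  have "(\<Sum>M\<in>S. (F M - m)\<^sup>2) = (\<Sum>M\<in>S. (F M)\<^sup>2 - 2 * m * F M + m\<^sup>2)"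
    by (simp add: power2_diff algebra_simps)
  also have "\<dots> = (\<Sum>M\<in>S. (F M)\<^sup>2) - 2 * m * (\<Sum>M\<in>S. F M) + N * m\<^sup>2"
    by (simp add: sum.distrib sum_subtractf sum_distrib_left N_def)
  also have "\<dots> \<le> N * (real (card A) * D + \<epsilon> * m\<^sup>2)"
    using sF2 unfolding sF by (simp add: power2_eq_square algebra_simps)
  finally have var: "(\<Sum>M\<in>S. (F M - m)\<^sup>2) \<le> N * (real (card A) * D + \<epsilon> * m\<^sup>2)" .
  let ?B = "{M \<in> S. \<bar>F M - m\<bar> \<ge> \<delta>}"
  have "real (card ?B) * \<delta>\<^sup>2 = (\<Sum>M\<in>?B. \<delta>\<^sup>2)" by simp
  also have "\<dots> \<le> (\<Sum>M\<in>?B. (F M - m)\<^sup>2)"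
    using \<delta> by (intro sum_mono) (auto simp: abs_le_square_iff[symmetric])
  also have "\<dots> \<le> (\<Sum>M\<in>S. (F M - m)\<^sup>2)" using S by (intro sum_mono2) auto
  also note var
  finally have "real (card ?B) / N \<le> (real (card A) * D + \<epsilon> * m\<^sup>2) / \<delta>\<^sup>2"
    using N \<delta> by (simp add: field_simps)
  then show ?thesis by (simp add: F_def m_def N_def)
qed

text \<open>This and the next two identities expand products in the binomial basis, whose averages
  are the ones computed above. The mixed product \<open>y * (y choose 2)\<close> serves the
  induction in \<open>square_choose_two\<close>.\<close>

lemma choose_two_square: "(y::nat)\<^sup>2 = y + 2 * (y choose 2)"
  by (induction y) (auto simp: numeral_2_eq_2 algebra_simps)

lemma choose_two_mult: "(y::nat) * (y choose 2) = 2 * (y choose 2) + 3 * (y choose 3)"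
proof (induction y)
  case (Suc y)
  then show ?case using choose_two_square[of y]
    by (simp add: numeral_2_eq_2 numeral_3_eq_3 algebra_simps)
qed simp

lemma square_choose_two: "((y::nat) choose 2)\<^sup>2 = (y choose 2) + 6 * (y choose 3) + 6 * (y choose 4)"
proof (induction y)
  case (Suc y)
  have "Suc y choose 2 = y + (y choose 2)" "Suc y choose 3 = (y choose 2) + (y choose 3)"
    "Suc y choose 4 = (y choose 3) + (y choose 4)"
    by (simp_all add: numeral_eq_Suc)
  then show ?case using Suc choose_two_square[of y] choose_two_mult[of y]
    by (simp add: power2_eq_square algebra_simps)
qed (simp add: numeral_eq_Suc)

lemma fact_mult_binomial_le: "fact k * (n choose k) \<le> n ^ k"
proof (cases "k \<le> n")
  case True
  then show ?thesis using binomial_fact_lemma[OF True] fact_div_fact_le_pow[OF True] 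
    by (metis fact_nonzero mult.assoc mult.commute nonzero_mult_div_cancel_left)
qed (simp add: binomial_eq_0)

section \<open>Asymptotics of edge probabilities\<close>

text \<open>A fixed r-set is an edge with probability asymptotic to \<open>edge_rate r\<close> /
  n^(r-1).\<close>

definition edge_rate :: "nat \<Rightarrow> real" where
  "edge_rate r = fact (r - 1) / real r ^ (r - 1)"

lemma edge_rate_pos: "r > 0 \<Longrightarrow> edge_rate r > 0"
  by (simp add: edge_rate_def)

text \<open>Equality holds at r = 2. The bound guarantees that subtracting the pairs cannot use up
  the hits, and it keeps all powers of the rate at most 1.\<close>

lemma edge_rate_le_half:
  assumes "r \<ge> 2"
  shows "edge_rate r \<le> 1 / 2"
proof -
  obtain k where k: "r = k + 2" using assms by (metis le_add_diff_inverse2)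
  have "fact (Suc k) \<le> real (k + 2) ^ k"
  proof (induction k)
    case (Suc k)
    have "fact (Suc (Suc k)) = real (k + 2) * fact (Suc k)" by (simp add: algebra_simps)
    also have "\<dots> \<le> real (k + 3) * real (k + 3) ^ k"
    proof (intro mult_mono)
      show "fact (Suc k) \<le> real (k + 3) ^ k"
        by (rule order_trans[OF Suc.IH power_mono]) auto
    qed auto
    finally show ?case by (simp add: eval_nat_numeral)
  qed simp
  then have "2 * fact (Suc k) \<le> real (k + 2) * real (k + 2) ^ k" by (intro mult_mono) auto
  moreover have "r - 1 = Suc k" "real r = real (k + 2)" using k by auto
  ultimately have "2 * fact (r - 1) \<le> real r ^ (r - 1)" by simp
  then show ?thesis using assms unfolding edge_rate_def by (subst pos_divide_le_eq) (auto simp del: fact_Suc)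
qed

lemma tendsto_binomial_ratio:
  assumes "r > 0"
  shows "(\<lambda>n. real ((r * n - 1) choose (r - 1)) / real n ^ (r - 1)) \<longlonglongrightarrow> 1 / edge_rate r"
proof -
  \<comment> \<open>The factor at \<open>i\<close> is (r n - 1 - i) / n; the falling factorial
    starts one below r n, hence \<open>Suc i\<close>.\<close>
  have "(\<lambda>n. (\<Prod>i = 0..<r - 1. real r - real (Suc i) / real n) / fact (r - 1))
      \<longlonglongrightarrow> (\<Prod>i = 0..<r - 1. real r - 0) / fact (r - 1)"
    by (intro tendsto_intros lim_const_over_n) auto
  moreover have "\<forall>\<^sub>F n in sequentially. (\<Prod>i = 0..<r - 1. real r - real (Suc i) / real n) / fact (r - 1) =
      real ((r * n - 1) choose (r - 1)) / real n ^ (r - 1)"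
  proof (rule eventually_sequentiallyI[of 1])
    fix n :: nat assume n: "1 \<le> n"
    have "(\<Prod>i = 0..<r - 1. real r - real (Suc i) / real n) =
        (\<Prod>i = 0..<r - 1. (real (r * n - 1) - real i) / real n)"
      using n assms by (intro prod.cong) (auto simp: field_simps of_nat_diff)
    also have "\<dots> = (\<Prod>i = 0..<r - 1. real (r * n - 1) - real i) / real n ^ (r - 1)"
      by (simp add: prod_dividef)
    finally show "(\<Prod>i = 0..<r - 1. real r - real (Suc i) / real n) / fact (r - 1) =
      real ((r * n - 1) choose (r - 1)) / real n ^ (r - 1)"
      by (simp add: binomial_gbinomial gbinomial_prod_rev)
  qed
  ultimately show ?thesis by (simp add: edge_rate_def filterlim_cong)
qed

text \<open>With \<open>s\<close> fixed, each factor is the preceding limit taken at n - i, and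
  replacing n - i by n costs a factor tending to 1.\<close>

lemma tendsto_edge_prob:
  assumes "r > 0"
  shows "(\<lambda>n. edge_prob r n s * real n ^ ((r - 1) * s)) \<longlonglongrightarrow> edge_rate r ^ s"
proof -
  define b where "b n = real ((r * n - 1) choose (r - 1))" for n
  have lim: "(\<lambda>n. b (n - i) / real n ^ (r - 1)) \<longlonglongrightarrow> 1 / edge_rate r" for i
  proof -
    have "(\<lambda>n. b (n - i) / real (n - i) ^ (r - 1)) \<longlonglongrightarrow> 1 / edge_rate r"
      unfolding b_def using tendsto_binomial_ratio[OF assms]
      by (rule filterlim_compose) (rule filterlim_minus_const_nat_at_top)
    moreover have "(\<lambda>n. (1 - real i / real n) ^ (r - 1)) \<longlonglongrightarrow> (1 - 0) ^ (r - 1)"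
      by (intro tendsto_intros lim_const_over_n)
    ultimately have "(\<lambda>n. b (n - i) / real (n - i) ^ (r - 1) * (1 - real i / real n) ^ (r - 1)) \<longlonglongrightarrow> 1 / edge_rate r * (1 - 0) ^ (r - 1)"
      by (rule tendsto_mult)
    moreover have "\<forall>\<^sub>F n in sequentially. b (n - i) / real (n - i) ^ (r - 1) * (1 - real i / real n) ^ (r - 1) = b (n - i) / real n ^ (r - 1)"
    proof (rule eventually_sequentiallyI[of "Suc i"])
      fix n assume n: "Suc i \<le> n"
      then have "1 - real i / real n = real (n - i) / real n" by (simp add: field_simps of_nat_diff)
      then show "b (n - i) / real (n - i) ^ (r - 1) * (1 - real i / real n) ^ (r - 1) = b (n - i) / real n ^ (r - 1)"
        using n by (simp add: power_divide)
    qed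
    ultimately show ?thesis by (simp add: filterlim_cong)
  qed
  have "(\<lambda>n. \<Prod>i<s. inverse (b (n - i) / real n ^ (r - 1))) \<longlonglongrightarrow> (\<Prod>i<s. inverse (1 / edge_rate r))"
    using edge_rate_pos[OF assms] by (intro tendsto_prod tendsto_inverse lim) auto
  moreover have "(\<Prod>i<s. inverse (b (n - i) / real n ^ (r - 1))) = edge_prob r n s * real n ^ ((r - 1) * s)" for n
    by (simp add: edge_prob_def b_def prod_dividef power_mult)
  ultimately show ?thesis by simp
qed

section \<open>Scale of the template and length of the blocks\<close>

definition template_size :: "nat \<Rightarrow> nat \<Rightarrow> nat" where
  "template_size r n = nat \<lfloor>real n powr (1 / real r)\<rfloor>"

text \<open>Rounding down keeps m L \<le> n, so that r m blocks of length L fit into the r n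
  vertices.\<close>

definition block_length :: "nat \<Rightarrow> nat \<Rightarrow> nat" where
  "block_length r n = n div template_size r n"

lemma template_size_bounds:
  "real (template_size r n) \<le> real n powr (1 / real r)"
  "real n powr (1 / real r) < real (template_size r n) + 1"
  unfolding template_size_def by (auto simp: of_nat_nat le_floor_iff)

lemma root_at_top:
  assumes "r > 0"
  shows "filterlim (\<lambda>n. real n powr (1 / real r)) at_top sequentially"
  using assms by (intro filterlim_compose[OF real_powr_at_top filterlim_real_sequentially]) auto

lemma template_size_at_top:
  assumes "r > 0"
  shows "filterlim (\<lambda>n. real (template_size r n)) at_top sequentially"
proof (rule filterlim_at_top_mono)
  show "filterlim (\<lambda>n. - 1 + real n powr (1 / real r)) at_top sequentially"
    by (rule filterlim_tendsto_add_at_top[OF tendsto_const root_at_top[OF assms]])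
  show "\<forall>\<^sub>F n in sequentially. - 1 + real n powr (1 / real r) \<le> real (template_size r n)"
    using template_size_bounds(2)[where r = r] by (intro always_eventually allI) (smt (verit))
qed

lemma eventually_template_size_ge:
  assumes "r > 0"
  shows "\<forall>\<^sub>F n in sequentially. k \<le> template_size r n"
proof -
  have "\<forall>\<^sub>F n in sequentially. real k \<le> real (template_size r n)"
    using template_size_at_top[OF assms] unfolding filterlim_at_top by blast
  then show ?thesis by simp
qed

lemma tendsto_template_ratio:
  assumes "r > 0"
  shows "(\<lambda>n. real (template_size r n) / real n powr (1 / real r)) \<longlonglongrightarrow> 1"
proof (rule tendsto_sandwich)
  let ?y = "\<lambda>n. real n powr (1 / real r)"
  have "(\<lambda>n. 1 - 1 / ?y n) \<longlonglongrightarrow> 1 - 0"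
    by (intro tendsto_diff tendsto_const tendsto_divide_0[OF tendsto_const]
        filterlim_at_top_imp_at_infinity[OF root_at_top[OF assms]])
  then show "(\<lambda>n. 1 - 1 / ?y n) \<longlonglongrightarrow> 1" by simp
  show "\<forall>\<^sub>F n in sequentially. 1 - 1 / ?y n \<le> real (template_size r n) / ?y n"
  proof (rule eventually_sequentiallyI[of 1])
    fix n :: nat assume "1 \<le> n"
    then have y: "?y n > 0" by simp
    then have "1 - 1 / ?y n = (?y n - 1) / ?y n" by (simp add: diff_divide_distrib)
    then show "1 - 1 / ?y n \<le> real (template_size r n) / ?y n"
      using template_size_bounds(2)[of n r] y by (simp add: divide_right_mono)
  qed
  show "\<forall>\<^sub>F n in sequentially. real (template_size r n) / ?y n \<le> 1"
  proof (rule eventually_sequentiallyI[of 1])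
    fix n :: nat assume "1 \<le> n"
    then have "?y n > 0" by simp
    then show "real (template_size r n) / ?y n \<le> 1"
      using template_size_bounds(1)[of r n] by simp
  qed
qed auto

text \<open>The division loses at most m \<le> n^(1/r) out of n, a relative error n^(1/r - 1), which
  vanishes for r \<ge> 2.\<close>

lemma tendsto_block_ratio:
  assumes "r \<ge> 2"
  shows "(\<lambda>n. real (block_length r n) * real (template_size r n) / real n) \<longlonglongrightarrow> 1"
proof (rule tendsto_sandwich)
  let ?y = "\<lambda>n. real n powr (1 / real r)"
  have "(\<lambda>n. 1 - real n powr (1 / real r - 1)) \<longlonglongrightarrow> 1 - 0"
    using assms by (intro tendsto_diff tendsto_const tendsto_neg_powr filterlim_real_sequentially)
      (auto simp: field_simps)
  then show "(\<lambda>n. 1 - real n powr (1 / real r - 1)) \<longlonglongrightarrow> 1" by simp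
  have ev: "\<forall>\<^sub>F n in sequentially. 1 \<le> template_size r n"
    using eventually_template_size_ge assms by simp
  show "\<forall>\<^sub>F n in sequentially. 1 - real n powr (1 / real r - 1) \<le>
      real (block_length r n) * real (template_size r n) / real n"
    using ev eventually_gt_at_top[of 0]
  proof eventually_elim
    case (elim n)
    let ?m = "template_size r n"
    have "n mod ?m \<le> ?m" using elim by (intro less_imp_le mod_less_divisor) auto
    moreover have "n = block_length r n * ?m + n mod ?m"
      unfolding block_length_def by (rule div_mult_mod_eq[symmetric])
    ultimately have "n \<le> block_length r n * ?m + ?m" by linarith
    then have "real n \<le> real (block_length r n * ?m + ?m)" by (rule of_nat_mono)
    then have "real n \<le> real (block_length r n) * real ?m + real ?m" by simp
    then have "real n - ?y n \<le> real (block_length r n) * real ?m"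
      using template_size_bounds(1)[of r n] by linarith
    then have "(real n - ?y n) / real n \<le> real (block_length r n) * real ?m / real n"
      by (rule divide_right_mono) simp
    moreover have "(real n - ?y n) / real n = 1 - real n powr (1 / real r - 1)"
      using elim by (simp add: powr_diff field_simps)
    ultimately show ?case by simp
  qed
  show "\<forall>\<^sub>F n in sequentially. real (block_length r n) * real (template_size r n) / real n \<le> 1"
    using eventually_gt_at_top[of 0]
  proof eventually_elim
    case (elim n)
    have "block_length r n * template_size r n \<le> n" by (simp add: block_length_def)
    then have "real (block_length r n) * real (template_size r n) \<le> real n"
      by (simp flip: of_nat_mult)
    then show ?case using elim by simp
  qed
qed auto

text \<open>With y = n^(1/r), the quotient of L m / n by m / y is L y / n, whose r-th power is L^r /
  n^(r-1) because y^r = n. So the number L^r of transversals cancels exactly the decay of the edge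
  probability.\<close>

lemma tendsto_block_edge_prob:
  assumes "r \<ge> 2"
  shows "(\<lambda>n. (real (block_length r n) ^ r) ^ s * edge_prob r n s) \<longlonglongrightarrow> edge_rate r ^ s"
proof -
  let ?y = "\<lambda>n. real n powr (1 / real r)"
  let ?m = "\<lambda>n. real (template_size r n)" and ?L = "\<lambda>n. real (block_length r n)"
  have "(\<lambda>n. ((?L n * ?m n / real n / (?m n / ?y n)) ^ r) ^ s * (edge_prob r n s * real n ^ ((r - 1) * s)))
    \<longlonglongrightarrow> ((1 / 1) ^ r) ^ s * edge_rate r ^ s"
    using assms
    by (intro tendsto_mult tendsto_power tendsto_divide tendsto_block_ratio tendsto_template_ratio tendsto_edge_prob) auto
  moreover have "\<forall>\<^sub>F n in sequentially.
     ((?L n * ?m n / real n / (?m n / ?y n)) ^ r) ^ s * (edge_prob r n s * real n ^ ((r - 1) * s)) =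
      (?L n ^ r) ^ s * edge_prob r n s"
  proof -
    have ev: "\<forall>\<^sub>F n in sequentially. 1 \<le> template_size r n"
      using eventually_template_size_ge assms by simp
    show ?thesis
      using ev eventually_gt_at_top[of 0]
    proof eventually_elim
      case (elim n)
      have "?L n * ?m n / real n / (?m n / ?y n) = ?L n * (?y n / real n)"
        using elim by simp
      moreover have "?y n ^ r = real n"
        using elim assms by (simp add: powr_realpow[symmetric] powr_powr)
      moreover have "real n ^ r = real n * real n ^ (r - 1)"
        using assms by (simp add: power_eq_if)
      ultimately have "(?L n * ?m n / real n / (?m n / ?y n)) ^ r = ?L n ^ r / real n ^ (r - 1)"
        using elim by (simp add: power_mult_distrib power_divide)
      then show ?case using elim by (simp add: power_divide power_mult)
    qed
  qed
  ultimately have "(\<lambda>n. (?L n ^ r) ^ s * edge_prob r n s) \<longlonglongrightarrow> ((1 / 1) ^ r) ^ s * edge_rate r ^ s"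
    by (rule Lim_transform_eventually)
  then show ?thesis by simp
qed

text \<open>Asymptotic independence of two disjoint groups of \<open>s\<close> edges: the powers of
  n cancel in the quotient. This supplies the \<open>\<epsilon>\<close> of the Chebyshev
  bound.\<close>

lemma tendsto_edge_prob_ratio:
  assumes "r > 0"
  shows "(\<lambda>n. \<bar>edge_prob r n (2 * s) / (edge_prob r n s)\<^sup>2 - 1\<bar>) \<longlonglongrightarrow> 0"
proof -
  let ?q = "\<lambda>s n. edge_prob r n s * real n ^ ((r - 1) * s)"
  have "(\<lambda>n. ?q (2 * s) n / (?q s n)\<^sup>2) \<longlonglongrightarrow> edge_rate r ^ (2 * s) / (edge_rate r ^ s)\<^sup>2"
    using edge_rate_pos[OF assms] by (intro tendsto_divide tendsto_power tendsto_edge_prob assms) auto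
  moreover have "edge_rate r ^ (2 * s) / (edge_rate r ^ s)\<^sup>2 = 1"
    using edge_rate_pos[OF assms] by (simp add: power_mult[symmetric] mult.commute)
  moreover have "\<forall>\<^sub>F n in sequentially. ?q (2 * s) n / (?q s n)\<^sup>2 = edge_prob r n (2 * s) / (edge_prob r n s)\<^sup>2"
  proof (rule eventually_sequentiallyI[of 1])
    fix n :: nat assume "1 \<le> n"
    then have "real n ^ ((r - 1) * (2 * s)) \<noteq> 0" by simp
    moreover have "(real n ^ ((r - 1) * s))\<^sup>2 = real n ^ ((r - 1) * (2 * s))"
      by (simp add: power_mult[symmetric] mult_ac)
    ultimately show "?q (2 * s) n / (?q s n)\<^sup>2 = edge_prob r n (2 * s) / (edge_prob r n s)\<^sup>2"
      by (simp only: power_mult_distrib nonzero_mult_divide_mult_cancel_right not_False_eq_True)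
  qed
  ultimately have "(\<lambda>n. edge_prob r n (2 * s) / (edge_prob r n s)\<^sup>2) \<longlonglongrightarrow> 1"
    by (simp add: filterlim_cong)
  then have "(\<lambda>n. edge_prob r n (2 * s) / (edge_prob r n s)\<^sup>2 - 1) \<longlonglongrightarrow> 1 - 1"
    by (intro tendsto_diff tendsto_const)
  then show ?thesis using tendsto_rabs_zero by simp
qed

section \<open>Concentration\<close>

lemma avg_choose_card_Int_le:
  assumes "r > 0" "finite V" "card V = r * n" "finite T" "\<And>e. e \<in> T \<Longrightarrow> e \<subseteq> V \<and> card e = r" "s \<le> n"
  shows "fact s * (\<Sum>M\<in>matchings r V. real (card (T \<inter> M) choose s)) \<le>
    real (card (matchings r V)) * (real (card T) ^ s * edge_prob r n s)"
proof -
  have "fact s * card (submatchings s T) \<le> fact s * (card T choose s)"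
    using card_submatchings_le[OF assms(4)] by (rule mult_le_mono2)
  also have "\<dots> \<le> card T ^ s" by (rule fact_mult_binomial_le)
  finally have "real (fact s * card (submatchings s T)) \<le> real (card T ^ s)" by (rule of_nat_mono)
  then have le: "fact s * real (card (submatchings s T)) \<le> real (card T) ^ s" by simp
  have "fact s * (\<Sum>M\<in>matchings r V. real (card (T \<inter> M) choose s)) =
      (fact s * real (card (submatchings s T))) * (edge_prob r n s * real (matching_count r n))"
    using sum_choose_card_Int[OF assms(1-5)] edge_prob_eq[OF assms(1,6)] by simp
  also have "\<dots> \<le> real (card T) ^ s * (edge_prob r n s * real (matching_count r n))"
    using edge_prob_nonneg by (intro mult_right_mono[OF le]) auto
  finally show ?thesis by (simp add: card_matchings[OF assms(1-3)] mult_ac)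
qed

text \<open>The squared pair count reaches binomials of order four, whence \<open>k \<le> 4\<close>
  and \<open>4 \<le> n\<close>. After division by the factorials the averages are at most 4 for
  \<open>s = 1\<close> and 7/2 for \<open>s = 2\<close>; 8 is a comfortable common bound.\<close>

lemma avg_square_choose_card_Int_le:
  assumes "r > 0" "finite V" "card V = r * n" "finite T" "\<And>e. e \<in> T \<Longrightarrow> e \<subseteq> V \<and> card e = r"
    and "4 \<le> n" "s \<in> {1, 2}" and x: "\<And>k. k \<le> 4 \<Longrightarrow> real (card T) ^ k * edge_prob r n k \<le> 2"
  shows "(\<Sum>M\<in>matchings r V. (real (card (T \<inter> M) choose s))\<^sup>2) \<le> real (card (matchings r V)) * 8"
proof -
  let ?N = "real (card (matchings r V))"
  let ?E = "\<lambda>k. \<Sum>M\<in>matchings r V. real (card (T \<inter> M) choose k)"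
  have E: "fact k * ?E k \<le> ?N * 2" if "k \<le> 4" for k
    using avg_choose_card_Int_le[OF assms(1-5), of k] that assms(6) mult_left_mono[OF x[OF that], of ?N] by simp
  have E1: "?E 1 \<le> ?N * 2" and E2: "2 * ?E 2 \<le> ?N * 2" and E3: "6 * ?E 3 \<le> ?N * 2" and E4: "24 * ?E 4 \<le> ?N * 2"
    using E[of 1] E[of 2] E[of 3] E[of 4] by (simp_all add: fact_numeral)
  have nn: "?E k \<ge> 0" for k by (intro sum_nonneg) auto
  show ?thesis
  proof (cases "s = 1")
    case True
    have "(\<Sum>M\<in>matchings r V. (real (card (T \<inter> M) choose s))\<^sup>2) = ?E 1 + 2 * ?E 2"
      unfolding True sum_distrib_left sum.distrib[symmetric]
      using choose_two_square by (intro sum.cong) (auto simp flip: of_nat_power)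
    then show ?thesis using E1 E2 by linarith
  next
    case False
    then have s: "s = 2" using assms(7) by simp
    have "(\<Sum>M\<in>matchings r V. (real (card (T \<inter> M) choose s))\<^sup>2) = ?E 2 + 6 * ?E 3 + 6 * ?E 4"
      unfolding s sum_distrib_left sum.distrib[symmetric]
      using square_choose_two by (intro sum.cong) (auto simp flip: of_nat_power)
    then show ?thesis using E2 E3 E4 nn[of 4] nn[of 2] by linarith
  qed
qed

text \<open>The means keep the exact number of submatchings: for \<open>s = 2\<close> two
  transversals of the same template edge may intersect, so this number can lie below
  \<open>t choose 2\<close>.\<close>

lemma choose_card_Int_deviation:
  assumes "r > 0" "finite V" "card V = r * n" "finite A"
    and T: "\<And>a. a \<in> A \<Longrightarrow> finite (T a)" "\<And>a e. a \<in> A \<Longrightarrow> e \<in> T a \<Longrightarrow> e \<subseteq> V \<and> card e = r"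
    and cT: "\<And>a. a \<in> A \<Longrightarrow> card (T a) = t"
    and dj: "\<And>a b e f. a \<in> A \<Longrightarrow> b \<in> A \<Longrightarrow> a \<noteq> b \<Longrightarrow> e \<in> T a \<Longrightarrow> f \<in> T b \<Longrightarrow> e \<inter> f = {}"
    and "4 \<le> n" "s \<in> {1, 2}" and x: "\<And>k. k \<le> 4 \<Longrightarrow> real t ^ k * edge_prob r n k \<le> 2"
    and \<epsilon>: "\<epsilon> = \<bar>edge_prob r n (2 * s) / (edge_prob r n s)\<^sup>2 - 1\<bar>" and \<delta>: "\<delta> > 0"
    and p: "edge_prob r n s > 0"
  shows "real (card {M \<in> matchings r V. \<bar>(\<Sum>a\<in>A. real (card (T a \<inter> M) choose s)) -
      (\<Sum>a\<in>A. real (card (submatchings s (T a))) * edge_prob r n s)\<bar> \<ge> \<delta>}) / real (card (matchings r V))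
    \<le> (real (card A) * 8 + \<epsilon> * (2 * real (card A))\<^sup>2) / \<delta>\<^sup>2"
proof -
  let ?\<mu> = "\<lambda>a. real (card (submatchings s (T a))) * edge_prob r n s"
  let ?S = "matchings r V"
  have s4: "s \<le> 4" "2 * s \<le> 4" "2 * s \<le> n" "s \<le> n" using assms(9,10) by auto
  have cS: "card ?S = matching_count r n" using card_matchings[OF assms(1-3)] .
  have Sne: "?S \<noteq> {}" using matching_count_pos[OF assms(1), of n] cS by auto
  have p2: "edge_prob r n (2 * s) \<le> (1 + \<epsilon>) * (edge_prob r n s)\<^sup>2"
  proof -
    have "edge_prob r n (2 * s) / (edge_prob r n s)\<^sup>2 \<le> 1 + \<epsilon>" unfolding \<epsilon> by linarith
    then show ?thesis using p by (simp add: divide_le_eq)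
  qed
  have "real (card {M \<in> ?S. \<bar>(\<Sum>a\<in>A. real (card (T a \<inter> M) choose s)) - (\<Sum>a\<in>A. ?\<mu> a)\<bar> \<ge> \<delta>}) / real (card ?S)
    \<le> (real (card A) * 8 + \<epsilon> * (\<Sum>a\<in>A. ?\<mu> a)\<^sup>2) / \<delta>\<^sup>2"
  proof (rule chebyshev_sum_card[OF finite_matchings[OF assms(2)] Sne assms(4) \<delta>])
    fix a assume a: "a \<in> A"
    show "(\<Sum>M\<in>?S. real (card (T a \<inter> M) choose s)) = real (card ?S) * ?\<mu> a"
      using sum_choose_card_Int[OF assms(1-3) T(1)[OF a] T(2)[OF a]] edge_prob_eq[OF assms(1) s4(4)] cS by simp
    show "(\<Sum>M\<in>?S. (real (card (T a \<inter> M) choose s))\<^sup>2) \<le> real (card ?S) * 8"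
      using avg_square_choose_card_Int_le[OF assms(1-3) T(1)[OF a] T(2)[OF a] assms(9,10)] x cT[OF a] by simp
  next
    fix a b assume a: "a \<in> A" and b: "b \<in> A" and ab: "a \<noteq> b"
    have "(\<Sum>M\<in>?S. real (card (T a \<inter> M) choose s) * real (card (T b \<inter> M) choose s)) =
        real (card (submatchings s (T a))) * real (card (submatchings s (T b))) * real (card ?S) * edge_prob r n (2 * s)"
      using sum_choose_card_Int_mult[OF assms(1-3) T(1)[OF a] T(2)[OF a] T(1)[OF b] T(2)[OF b] dj[OF a b ab]]
        edge_prob_eq[OF assms(1) s4(3)] cS by simp
    also have "\<dots> \<le> real (card (submatchings s (T a))) * real (card (submatchings s (T b))) * real (card ?S) *
        ((1 + \<epsilon>) * (edge_prob r n s)\<^sup>2)"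
      by (intro mult_left_mono[OF p2]) auto
    finally show "(\<Sum>M\<in>?S. real (card (T a \<inter> M) choose s) * real (card (T b \<inter> M) choose s))
        \<le> real (card ?S) * ((1 + \<epsilon>) * (?\<mu> a * ?\<mu> b))"
      by (simp add: power2_eq_square mult_ac)
  qed (auto simp: \<epsilon>)
  \<comment> \<open>Each mean is dominated by \<open>t ^ s * edge_prob r n s\<close>, for which 2 is
    the assumed bound.\<close>
  also have "(\<Sum>a\<in>A. ?\<mu> a)\<^sup>2 \<le> (2 * real (card A))\<^sup>2"
  proof (rule power_mono)
    have "?\<mu> a \<le> 2" if a: "a \<in> A" for a
    proof -
      have "card (submatchings s (T a)) \<le> fact s * (card (T a) choose s)"
        using card_submatchings_le[OF T(1)[OF a], of s] by (metis fact_ge_1 le_trans mult_le_mono1 nat_mult_1)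
      also have "\<dots> \<le> t ^ s" using fact_mult_binomial_le cT[OF a] by metis
      finally have "real (card (submatchings s (T a))) \<le> real (t ^ s)" by (rule of_nat_mono)
      then have "?\<mu> a \<le> real t ^ s * edge_prob r n s" using p by (intro mult_right_mono) auto
      then show ?thesis using x[OF s4(1)] by linarith
    qed
    then have "(\<Sum>a\<in>A. ?\<mu> a) \<le> (\<Sum>a\<in>A. 2)" by (rule sum_mono)
    then show "(\<Sum>a\<in>A. ?\<mu> a) \<le> 2 * real (card A)" by simp
    show "(\<Sum>a\<in>A. ?\<mu> a) \<ge> 0" using p by (intro sum_nonneg) auto
  qed
  finally show ?thesis using \<epsilon> \<delta> by (auto simp: divide_right_mono mult_left_mono)
qed

section \<open>Lower tail of the maximal clique size\<close>

lemma card_clique_le_max_clique_size: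
  assumes "M \<in> ordered_matchings r n" "K \<subseteq> M" "is_clique r P K"
  shows "card K \<le> max_clique_size r P M"
  unfolding max_clique_size_def
  using clique_sizes_finite_nonempty(1)[OF assms(1)] assms(2,3) by (intro Max_ge) auto

text \<open>Termwise this is a Bonferroni inequality: y - (y choose 2) is at most 1, and it is 0 at
  y = 0, so it never exceeds the indicator of a hit.\<close>

lemma max_clique_size_ge_hits:
  fixes L :: nat
  assumes M: "M \<in> ordered_matchings r n" and K: "is_clique r P K" "r > 0"
  defines "T \<equiv> \<lambda>a. transversals L (position K ` a)"
  shows "(\<Sum>a\<in>K. real (card (T a \<inter> M) choose 1)) - (\<Sum>a\<in>K. real (card (T a \<inter> M) choose 2))
    \<le> real (max_clique_size r P M)"
proof -
  define H where "H = {a \<in> K. T a \<inter> M \<noteq> {}}"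
  have fK: "finite K" using K by (simp add: is_clique_def)
  have fM: "finite M" using M finite_elements by (auto simp: ordered_matchings_def)
  define F where "F a = (SOME e. e \<in> T a \<inter> M)" for a
  have F: "F a \<in> T a \<inter> M" if "a \<in> H" for a
    unfolding F_def using that by (intro some_in_eq[THEN iffD2]) (auto simp: H_def)
  have cl: "is_clique r P (F ` H)" "card (F ` H) = card H"
    using clique_of_transversals[OF K, of H F L] F by (auto simp: H_def T_def)
  have "(\<Sum>a\<in>K. real (card (T a \<inter> M) choose 1)) - (\<Sum>a\<in>K. real (card (T a \<inter> M) choose 2))
      = (\<Sum>a\<in>K. real (card (T a \<inter> M) choose 1) - real (card (T a \<inter> M) choose 2))"
    by (simp add: sum_subtractf)
  also have "\<dots> \<le> (\<Sum>a\<in>K. of_bool (T a \<inter> M \<noteq> {}))"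
  proof (rule sum_mono)
    fix a
    have bon: "real (y choose 1) - real (y choose 2) \<le> 1" for y
    proof (induction y)
      case (Suc y)
      have "Suc y choose 2 = y + (y choose 2)" by (simp add: numeral_2_eq_2)
      then show ?case using Suc by (cases y) auto
    qed simp
    show "real (card (T a \<inter> M) choose 1) - real (card (T a \<inter> M) choose 2) \<le> of_bool (T a \<inter> M \<noteq> {})"
    proof (cases "T a \<inter> M = {}")
      case False
      then show ?thesis using bon[of "card (T a \<inter> M)"] by simp
    qed simp
  qed
  also have "\<dots> = real (card H)" using fK by (simp add: H_def of_bool_def sum.If_cases Int_def)
  also have "\<dots> \<le> real (max_clique_size r P M)"
    using card_clique_le_max_clique_size[OF M _ cl(1)] cl(2) F by auto
  finally show ?thesis .
qed

text \<open>In units of c m / 40 the first mean is at least 36, the second at most 11, and outside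
  the exceptional sets each sum deviates by less than one unit \<open>\<delta>\<close>. The
  remaining 23 units exceed c m / 2, which is 20 units.\<close>

lemma small_max_clique_prob_le:
  assumes r: "r > 0" and K: "is_clique r P K" "card K = m" and m: "m > 0" "m * L \<le> n" and n: "4 \<le> n"
    and p: "edge_prob r n 1 > 0" "edge_prob r n 2 > 0" and c: "c > 0"
    and x: "\<And>k. k \<le> 4 \<Longrightarrow> (real L ^ r) ^ k * edge_prob r n k \<le> 2"
    and x1: "real L ^ r * edge_prob r n 1 \<ge> 9 / 10 * c"
    and x2: "(real L ^ r)\<^sup>2 * edge_prob r n 2 \<le> 11 / 20 * c"
  shows "real (card {M \<in> ordered_matchings r n. real (max_clique_size r P M) < c / 2 * real m}) /
      real (card (ordered_matchings r n)) \<le>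
    1600 / c\<^sup>2 * (16 / real m + 4 * \<bar>edge_prob r n 2 / (edge_prob r n 1)\<^sup>2 - 1\<bar>
       + 4 * \<bar>edge_prob r n 4 / (edge_prob r n 2)\<^sup>2 - 1\<bar>)"
proof -
  define V where "V = {1..r * n}"
  define S where "S = matchings r V"
  define T where "T a = transversals L (position K ` a)" for a
  define \<delta> where "\<delta> = c * real m / 40"
  define F where "F s M = (\<Sum>a\<in>K. real (card (T a \<inter> M) choose s))" for s M
  define \<mu> where "\<mu> s = (\<Sum>a\<in>K. real (card (submatchings s (T a))) * edge_prob r n s)" for s
  define B where "B s = {M \<in> S. \<bar>F s M - \<mu> s\<bar> \<ge> \<delta>}" for s
  define \<epsilon> where "\<epsilon> s = \<bar>edge_prob r n (2 * s) / (edge_prob r n s)\<^sup>2 - 1\<bar>" for s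
  have V: "finite V" "card V = r * n" by (simp_all add: V_def)
  have S: "S = ordered_matchings r n" using ordered_matchings_eq[OF r] by (simp add: S_def V_def)
  have fS: "finite S" by (simp add: S finite_ordered_matchings)
  have fK: "finite K" and cK: "\<And>a. a \<in> K \<Longrightarrow> card a = r" and dK: "disjoint K"
    using K(1) by (auto simp: is_clique_def)
  have fU: "finite (\<Union>K)" and cU: "card (\<Union>K) = r * m" using clique_partition_on[OF K(1) r] K(2) by auto
  have inj: "inj_on (position K) (\<Union>K)"
    using position_strict_mono[OF fU] by (rule strict_mono_on_imp_inj_on)
  have cJ: "finite (position K ` a)" "card (position K ` a) = r" "position K ` a \<subseteq> {..<r * m}" if "a \<in> K" for a
  proof -
    have sub: "a \<subseteq> \<Union>K" using that by auto
    show "finite (position K ` a)" using finite_subset[OF sub fU] by simp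
    show "card (position K ` a) = r" using cK[OF that] card_image[OF inj_on_subset[OF inj sub]] by simp
    show "position K ` a \<subseteq> {..<r * m}"
      using position_less[OF fU] that cU by auto
  qed
  have cT: "card (T a) = L ^ r" if "a \<in> K" for a
    unfolding T_def using card_transversals[OF cJ(1)[OF that]] cJ(2)[OF that] by simp
  have fT: "finite (T a)" if "a \<in> K" for a
    unfolding T_def transversals_def
    by (rule finite_imageI, rule finite_PiE[OF cJ(1)[OF that]]) simp
  have Te: "e \<subseteq> V \<and> card e = r" if "a \<in> K" "e \<in> T a" for a e
  proof
    have "e \<subseteq> {1..(r * m) * L}" using transversal_subset[OF _ cJ(3)[OF that(1)]] that(2) by (simp add: T_def)
    also have "\<dots> \<subseteq> V" using mult_le_mono2[OF m(2), of r] by (simp add: V_def mult.assoc)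
    finally show "e \<subseteq> V" .
    show "card e = r"
      using bij_betw_same_card[OF transversal_bij] cJ(2)[OF that(1)] that(2) by (simp add: T_def)
  qed
  have Td: "e \<inter> f = {}" if "a \<in> K" "b \<in> K" "a \<noteq> b" "e \<in> T a" "f \<in> T b" for a b e f
  proof -
    have "a \<inter> b = {}" using disjointD[OF dK that(1-3)] .
    moreover have "position K ` a \<inter> position K ` b = position K ` (a \<inter> b)"
      using that by (intro inj_on_image_Int[OF inj, symmetric]) auto
    ultimately show ?thesis
      using transversals_disjoint that(4,5) by (simp add: T_def)
  qed
  have \<delta>: "\<delta> > 0" using c m by (simp add: \<delta>_def)
  have dev: "real (card (B s)) / real (card S) \<le> (real m * 8 + \<epsilon> s * (2 * real m)\<^sup>2) / \<delta>\<^sup>2"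
    if s: "s \<in> {1, 2}" and p: "edge_prob r n s > 0" for s
    unfolding B_def S_def F_def \<mu>_def K(2)[symmetric]
    using x
    by (intro choose_card_Int_deviation[OF r V fK fT Te cT Td n s _ \<epsilon>_def \<delta> p]) auto
  have \<mu>1: "\<mu> 1 \<ge> 9 / 10 * c * real m"
  proof -
    have "\<mu> 1 = (\<Sum>a\<in>K. real L ^ r * edge_prob r n 1)"
      unfolding \<mu>_def card_submatchings_1 by (intro sum.cong) (auto simp: cT)
    also have "\<dots> = real m * (real L ^ r * edge_prob r n 1)" by (simp add: K(2))
    finally show ?thesis using mult_left_mono[OF x1, of "real m"] by (simp add: mult_ac)
  qed
  have \<mu>2: "\<mu> 2 \<le> 11 / 40 * c * real m"
  proof -
    have "2 * (real (card (submatchings 2 (T a))) * edge_prob r n 2) \<le> 11 / 20 * c" if a: "a \<in> K" for a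
    proof -
      have "2 * card (submatchings 2 (T a)) \<le> fact 2 * (card (T a) choose 2)"
        using card_submatchings_le[OF fT[OF a], of 2] by simp
      also have "\<dots> \<le> (L ^ r)\<^sup>2" using fact_mult_binomial_le cT[OF a] by metis
      finally have "real (2 * card (submatchings 2 (T a))) \<le> real ((L ^ r)\<^sup>2)" by (rule of_nat_mono)
      then have "(2 * real (card (submatchings 2 (T a)))) * edge_prob r n 2 \<le> (real L ^ r)\<^sup>2 * edge_prob r n 2"
        using p by (intro mult_right_mono) auto
      then show ?thesis using x2 by linarith
    qed
    then have "(\<Sum>a\<in>K. 2 * (real (card (submatchings 2 (T a))) * edge_prob r n 2)) \<le> (\<Sum>a\<in>K. 11 / 20 * c)"
      by (rule sum_mono)
    then have "2 * \<mu> 2 \<le> real m * (11 / 20 * c)" by (simp add: \<mu>_def sum_distrib_left K(2))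
    then show ?thesis by (simp add: mult_ac)
  qed
  have sub: "{M \<in> S. real (max_clique_size r P M) < c / 2 * real m} \<subseteq> B 1 \<union> B 2"
  proof (rule subsetI, rule ccontr)
    fix M assume M: "M \<in> {M \<in> S. real (max_clique_size r P M) < c / 2 * real m}" and nB: "M \<notin> B 1 \<union> B 2"
    then have "\<bar>F 1 M - \<mu> 1\<bar> < \<delta>" "\<bar>F 2 M - \<mu> 2\<bar> < \<delta>" by (auto simp: B_def)
    then have "F 1 M - F 2 M > \<mu> 1 - \<mu> 2 - 2 * \<delta>" by linarith
    moreover have "\<mu> 1 - \<mu> 2 - 2 * \<delta> \<ge> 23 / 40 * (c * real m)"
      using \<mu>1 \<mu>2 by (simp add: \<delta>_def)
    moreover have "F 1 M - F 2 M \<le> real (max_clique_size r P M)"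
      unfolding F_def T_def using M by (intro max_clique_size_ge_hits[OF _ K(1) r]) (auto simp: S)
    moreover have "real (max_clique_size r P M) < c * real m / 2" using M by simp
    moreover have "c * real m > 0" using c m by simp
    ultimately show False by linarith
  qed
  have "card {M \<in> S. real (max_clique_size r P M) < c / 2 * real m} \<le> card (B 1 \<union> B 2)"
    using fS by (intro card_mono[OF _ sub]) (auto simp: B_def)
  also have "\<dots> \<le> card (B 1) + card (B 2)" by (rule card_Un_le)
  finally have "real (card {M \<in> S. real (max_clique_size r P M) < c / 2 * real m}) \<le> real (card (B 1)) + real (card (B 2))"
    by linarith
  then have "real (card {M \<in> S. real (max_clique_size r P M) < c / 2 * real m}) / real (card S)
      \<le> (real (card (B 1)) + real (card (B 2))) / real (card S)" by (rule divide_right_mono) simp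
  also have "\<dots> \<le> (real m * 8 + \<epsilon> 1 * (2 * real m)\<^sup>2) / \<delta>\<^sup>2 + (real m * 8 + \<epsilon> 2 * (2 * real m)\<^sup>2) / \<delta>\<^sup>2"
    unfolding add_divide_distrib[of "real (card (B 1))"] using p by (intro add_mono dev) auto
  \<comment> \<open>1600 is the square of the 40 in \<open>\<delta>\<close>, 16 collects the two
    diagonal terms 8, and each 4 stems from the square of 2 m.\<close>
  also have "\<dots> = 1600 / c\<^sup>2 * (16 / real m + 4 * \<epsilon> 1 + 4 * \<epsilon> 2)"
    using c m by (simp add: \<delta>_def power2_eq_square field_simps)
  finally show ?thesis by (simp add: S \<epsilon>_def)
qed

section \<open>Upper tail of the maximal clique size\<close>

lemma large_clique_prob_le:
  assumes "is_pattern r P" "r > 0"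
  shows "real (card {M \<in> ordered_matchings r n. k \<le> max_clique_size r P M}) / real (card (ordered_matchings r n))
    \<le> real n ^ k / fact k ^ r"
proof -
  let ?S = "matchings r {1..r * n}"
  have S: "ordered_matchings r n = ?S" using ordered_matchings_eq[OF assms(2)] .
  have cS: "card ?S = matching_count r n" using card_matchings[OF assms(2), of "{1..r * n}" n] by simp
  have sub: "{M \<in> ?S. k \<le> max_clique_size r P M} \<subseteq> {M \<in> ?S. \<exists>K\<subseteq>M. is_clique r P K \<and> card K = k}"
  proof clarify
    fix M assume M: "M \<in> ?S" "k \<le> max_clique_size r P M"
    have "max_clique_size r P M \<in> {card K | K. K \<subseteq> M \<and> is_clique r P K}"
      unfolding max_clique_size_def using M S by (intro Max_in clique_sizes_finite_nonempty) auto
    then obtain K where K: "K \<subseteq> M" "is_clique r P K" "k \<le> card K" using M(2) by auto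
    \<comment> \<open>Cliques are closed under taking subsets, so a larger one contains one of size
      exactly \<open>k\<close>.\<close>
    then obtain L where "L \<subseteq> K" "card L = k" by (meson obtain_subset_with_card_n)
    then show "\<exists>K\<subseteq>M. is_clique r P K \<and> card K = k" using K is_clique_subset by blast
  qed
  have "card {M \<in> ?S. k \<le> max_clique_size r P M} \<le> card {M \<in> ?S. \<exists>K\<subseteq>M. is_clique r P K \<and> card K = k}"
    using finite_matchings[of "{1..r * n}" r] by (intro card_mono[OF _ sub]) auto
  also have "\<dots> \<le> ((r * n) choose (r * k)) * matching_count r (n - k)"
    using assms by (intro card_matchings_with_clique_le) auto
  finally have le: "real (card {M \<in> ?S. k \<le> max_clique_size r P M}) \<le> real ((r * n) choose (r * k)) * real (matching_count r (n - k))"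
    by (metis of_nat_le_iff of_nat_mult)
  have pos: "real (matching_count r n) > 0" using matching_count_pos[OF assms(2)] by simp
  show ?thesis
  proof (cases "k \<le> n")
    case True
    have "real (card {M \<in> ?S. k \<le> max_clique_size r P M}) \<le> real ((r * n) choose (r * k)) * edge_prob r n k * real (matching_count r n)"
      using le unfolding edge_prob_eq[OF assms(2) True] by (simp add: mult.assoc)
    also have "\<dots> \<le> real n ^ k / fact k ^ r * real (matching_count r n)"
      by (intro mult_right_mono binomial_edge_prob_le[OF assms(2) True]) simp
    finally show ?thesis using pos unfolding S cS by (simp only: pos_divide_le_eq)
  next
    \<comment> \<open>For \<open>k > n\<close> the value of \<open>edge_prob\<close> carries no
      meaning, but the binomial coefficient vanishes, so no such clique exists.\<close>
    case False
    then have "real (card {M \<in> ?S. k \<le> max_clique_size r P M}) \<le> 0"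
      using le assms(2) by (simp add: binomial_eq_0)
    then have "real (card (?S \<inter> {M. k \<le> max_clique_size r P M})) = 0" by (simp add: Int_def)
    then show ?thesis unfolding S by (simp add: Int_def)
  qed
qed

text \<open>With y = n^(1/r) the left side is (y^k / k!)^r. From k! \<ge> (k/e)^k and k \<ge> 2 e y
  follows k! \<ge> (2 y)^k, which is where the constant 2 e comes from.\<close>

lemma power_div_fact_le:
  assumes "r > 0" "2 * exp 1 * real n powr (1 / real r) \<le> real k" "n > 0"
  shows "real n ^ k / fact k ^ r \<le> (1 / 2) ^ k"
proof -
  let ?y = "real n powr (1 / real r)"
  have yr: "?y ^ r = real n" using assms by (simp add: powr_realpow[symmetric] powr_powr)
  have k: "k > 0"
  proof (rule ccontr)
    assume "\<not> k > 0"
    moreover have "2 * exp 1 * ?y > 0" using assms(3) by simp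
    ultimately show False using assms(2) by simp
  qed
  \<comment> \<open>The quotient is a single term of the exponential series at k.\<close>
  have "real k ^ k / fact k \<le> exp (real k)"
  proof -
    have "(\<lambda>i. real k ^ i /\<^sub>R fact i) sums exp (real k)" by (rule exp_converges)
    then have "(\<Sum>i\<in>{k}. real k ^ i /\<^sub>R fact i) \<le> exp (real k)"
      using sum_le_suminf[of "\<lambda>i. real k ^ i /\<^sub>R fact i" "{k}"] by (simp add: sums_iff)
    then show ?thesis by (simp add: divide_inverse mult.commute)
  qed
  then have f: "(real k / exp 1) ^ k \<le> fact k"
    by (simp add: power_divide exp_of_nat_mult[symmetric] field_simps)
  have "(2 * real n) ^ k \<le> ((2 * ?y) ^ r) ^ k"
  proof (rule power_mono)
    have "2 * real n \<le> 2 ^ r * ?y ^ r"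
      unfolding yr using assms(1) self_le_power[of "2::real" r] by (intro mult_right_mono) auto
    then show "2 * real n \<le> (2 * ?y) ^ r" by (simp add: power_mult_distrib)
  qed simp
  also have "\<dots> = ((2 * ?y) ^ k) ^ r" by (simp only: power_mult[symmetric] mult.commute)
  also have "\<dots> \<le> ((real k / exp 1) ^ k) ^ r"
    using assms(2) by (intro power_mono) (auto simp: field_simps)
  also have "\<dots> \<le> fact k ^ r" using f by (intro power_mono) auto
  finally have "2 ^ k * real n ^ k \<le> fact k ^ r" by (simp add: power_mult_distrib)
  then show ?thesis by (simp add: power_divide field_simps)
qed

section \<open>Passage to the limit\<close>

lemma small_max_clique_prob_tendsto:
  assumes r: "r \<ge> 2" and P: "collectable r P"
  shows "(\<lambda>n. real (card {M \<in> ordered_matchings r n.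
      real (max_clique_size r P M) < edge_rate r / 4 * real n powr (1 / real r)}) /
      real (card (ordered_matchings r n))) \<longlonglongrightarrow> 0"
proof (rule tendsto_sandwich[OF _ _ tendsto_const])
  have r0: "r > 0" using r by simp
  let ?c = "edge_rate r"
  let ?p = "edge_prob r"
  let ?m = "template_size r" and ?L = "block_length r"
  have c: "?c > 0" "?c \<le> 1 / 2" using edge_rate_pos[OF r0] edge_rate_le_half[OF r] by auto
  let ?g = "\<lambda>n. 1600 / ?c\<^sup>2 * (16 / real (?m n) + 4 * \<bar>?p n 2 / (?p n 1)\<^sup>2 - 1\<bar> + 4 * \<bar>?p n 4 / (?p n 2)\<^sup>2 - 1\<bar>)"
  have "?g \<longlonglongrightarrow> 1600 / ?c\<^sup>2 * (0 + 4 * 0 + 4 * 0)"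
    using tendsto_edge_prob_ratio[OF r0, of 1] tendsto_edge_prob_ratio[OF r0, of 2]
    by (intro tendsto_mult tendsto_add tendsto_const tendsto_divide_0[OF tendsto_const]
        filterlim_at_top_imp_at_infinity[OF template_size_at_top[OF r0]]) simp_all
  then show "?g \<longlonglongrightarrow> 0" by simp
  have lim: "(\<lambda>n. (real (?L n) ^ r) ^ k * ?p n k) \<longlonglongrightarrow> ?c ^ k" for k
    by (rule tendsto_block_edge_prob[OF r])
  \<comment> \<open>The limits are powers of the rate and hence at most 1, so 2 leaves room for all
    five exponents.\<close>
  have ev2: "\<forall>\<^sub>F n in sequentially. \<forall>k\<in>{..4}. (real (?L n) ^ r) ^ k * ?p n k \<le> 2"
  proof (intro eventually_ball_finite ballI)
    fix k
    have "?c ^ k \<le> 1" using c by (intro power_le_one) auto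
    then show "\<forall>\<^sub>F n in sequentially. (real (?L n) ^ r) ^ k * ?p n k \<le> 2"
      using order_tendstoD(2)[OF lim[of k], of 2] by (auto elim: eventually_mono)
  qed simp
  have ev3: "\<forall>\<^sub>F n in sequentially. 9 / 10 * ?c \<le> (real (?L n) ^ r) ^ 1 * ?p n 1"
    using order_tendstoD(1)[OF lim[of 1], of "9 / 10 * ?c"] c by (auto elim: eventually_mono)
  \<comment> \<open>Since the rate is at most 1/2, the limit of the pair term lies strictly below
    11/20 of the rate.\<close>
  have "?c ^ 2 \<le> 1 / 2 * ?c" unfolding power2_eq_square using c by (intro mult_right_mono) auto
  then have ev4: "\<forall>\<^sub>F n in sequentially. (real (?L n) ^ r) ^ 2 * ?p n 2 \<le> 11 / 20 * ?c"
    using order_tendstoD(2)[OF lim[of 2], of "11 / 20 * ?c"] c by (auto elim: eventually_mono)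
  have evp: "\<forall>\<^sub>F n in sequentially. 0 < ?p n s" for s
    using order_tendstoD(1)[OF tendsto_edge_prob[OF r0, of s], of 0] c(1)
    by (auto elim!: eventually_mono simp: zero_less_mult_iff edge_prob_nonneg not_less[symmetric])
  show "\<forall>\<^sub>F n in sequentially. real (card {M \<in> ordered_matchings r n.
      real (max_clique_size r P M) < ?c / 4 * real n powr (1 / real r)}) / real (card (ordered_matchings r n)) \<le> ?g n"
    using ev2 ev3 ev4 evp[of 1] evp[of 2] eventually_template_size_ge[OF r0, of 2] eventually_ge_at_top[of 4]
  proof eventually_elim
    case (elim n)
    \<comment> \<open>Collectability speaks of sizes from 2 on, which
      \<open>template_size r n\<close> eventually reaches.\<close>
    obtain K where K: "is_clique r P K" "card K = ?m n"
      using P elim(6) by (auto simp: collectable_def)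
    \<comment> \<open>Rounding the root down costs at most a factor 2, which turns the factor 1/2 in
      front of the template size into 1/4 in front of n^(1/r).\<close>
    have "real n powr (1 / real r) \<le> 2 * real (?m n)"
      using template_size_bounds(2)[of n r] elim(6) by linarith
    then have "?c / 4 * real n powr (1 / real r) \<le> ?c / 4 * (2 * real (?m n))"
      using c by (intro mult_left_mono) auto
    then have "?c / 4 * real n powr (1 / real r) \<le> ?c / 2 * real (?m n)" by simp
    then have "card {M \<in> ordered_matchings r n. real (max_clique_size r P M) < ?c / 4 * real n powr (1 / real r)}
        \<le> card {M \<in> ordered_matchings r n. real (max_clique_size r P M) < ?c / 2 * real (?m n)}"
      by (intro card_mono) (auto simp: finite_ordered_matchings)
    then have "real (card {M \<in> ordered_matchings r n. real (max_clique_size r P M) < ?c / 4 * real n powr (1 / real r)})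
          / real (card (ordered_matchings r n))
        \<le> real (card {M \<in> ordered_matchings r n. real (max_clique_size r P M) < ?c / 2 * real (?m n)})
          / real (card (ordered_matchings r n))"
      by (intro divide_right_mono) auto
    also have "\<dots> \<le> ?g n"
    proof (rule small_max_clique_prob_le[OF r0 K])
      show "?m n * ?L n \<le> n" by (simp add: block_length_def)
    qed (use elim c in auto)
    finally show ?case .
  qed
qed auto

lemma large_max_clique_prob_tendsto:
  assumes r: "r > 0" and P: "is_pattern r P"
  shows "(\<lambda>n. real (card {M \<in> ordered_matchings r n.
      2 * exp 1 * real n powr (1 / real r) < real (max_clique_size r P M)}) /
      real (card (ordered_matchings r n))) \<longlonglongrightarrow> 0"
proof (rule tendsto_sandwich[OF _ _ tendsto_const])
  \<comment> \<open>The union bound needs a natural size; an integer above the real threshold is at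
    least its ceiling.\<close>
  let ?k = "\<lambda>n. nat \<lceil>2 * exp 1 * real n powr (1 / real r)\<rceil>"
  have k: "2 * exp 1 * real n powr (1 / real r) \<le> real (?k n)" for n by linarith
  have "filterlim (\<lambda>n. 2 * exp 1 * real n powr (1 / real r)) at_top sequentially"
    by (intro filterlim_tendsto_pos_mult_at_top[OF tendsto_const _ root_at_top[OF r]]) simp
  then have "filterlim (\<lambda>n. real (?k n)) at_top sequentially"
    by (rule filterlim_at_top_mono) (use k in simp)
  then have "filterlim ?k at_top sequentially"
    by (simp add: filterlim_sequentially_iff_filterlim_real)
  then show "(\<lambda>n. (1 / 2 :: real) ^ ?k n) \<longlonglongrightarrow> 0"
    by (intro filterlim_compose[OF LIMSEQ_power_zero]) auto
  show "\<forall>\<^sub>F n in sequentially. real (card {M \<in> ordered_matchings r n.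
      2 * exp 1 * real n powr (1 / real r) < real (max_clique_size r P M)}) /
      real (card (ordered_matchings r n)) \<le> (1 / 2) ^ ?k n"
    using eventually_gt_at_top[of 0]
  proof eventually_elim
    case (elim n)
    have "card {M \<in> ordered_matchings r n. 2 * exp 1 * real n powr (1 / real r) < real (max_clique_size r P M)}
        \<le> card {M \<in> ordered_matchings r n. ?k n \<le> max_clique_size r P M}"
      by (intro card_mono) (auto simp: finite_ordered_matchings nat_le_iff ceiling_le_iff)
    then have "real (card {M \<in> ordered_matchings r n. 2 * exp 1 * real n powr (1 / real r) < real (max_clique_size r P M)})
          / real (card (ordered_matchings r n))
        \<le> real (card {M \<in> ordered_matchings r n. ?k n \<le> max_clique_size r P M}) / real (card (ordered_matchings r n))"
      by (intro divide_right_mono) auto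
    also have "\<dots> \<le> real n ^ ?k n / fact (?k n) ^ r" by (rule large_clique_prob_le[OF P r])
    also have "\<dots> \<le> (1 / 2) ^ ?k n" using elim by (intro power_div_fact_le[OF r k])
    finally show ?case .
  qed
qed auto

theorem theorem1p8:
  fixes r :: nat
  assumes "r \<ge> 2"
  shows "\<exists>c C :: real. 0 < c \<and> c \<le> C \<and>
    (\<forall>P. is_pattern r P \<and> collectable r P \<longrightarrow>
      (\<lambda>n. measure_pmf.prob (pmf_of_set (ordered_matchings r n))
             {M. c * real n powr (1 / real r) \<le> real (max_clique_size r P M) \<and>
                 real (max_clique_size r P M) \<le> C * real n powr (1 / real r)})
        \<longlonglongrightarrow> 1)"
proof (intro exI conjI allI impI)
  have r0: "r > 0" using assms by simp
  \<comment> \<open>One factor 1/2 pays for pairs and deviations, the other for rounding the root; 2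
    e is the multiple at which the union bound drops to (1/2)^k. Neither involves the pattern, so
    both are fixed before \<open>P\<close>.\<close>
  let ?c = "edge_rate r / 4" and ?C = "2 * exp 1 :: real"
  show "0 < ?c" using edge_rate_pos[OF r0] by simp
  have "exp 1 \<ge> (1 :: real)" by simp
  then show "?c \<le> ?C" using edge_rate_le_half[OF assms] by linarith
  fix P assume P: "is_pattern r P \<and> collectable r P"
  let ?S = "ordered_matchings r"
  let ?lo = "\<lambda>n. {M \<in> ?S n. real (max_clique_size r P M) < ?c * real n powr (1 / real r)}"
  let ?hi = "\<lambda>n. {M \<in> ?S n. ?C * real n powr (1 / real r) < real (max_clique_size r P M)}"
  let ?good = "\<lambda>n. {M. ?c * real n powr (1 / real r) \<le> real (max_clique_size r P M) \<and>
                 real (max_clique_size r P M) \<le> ?C * real n powr (1 / real r)}"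
  show "(\<lambda>n. measure_pmf.prob (pmf_of_set (?S n)) (?good n)) \<longlonglongrightarrow> 1"
  proof (rule tendsto_sandwich)
    have "(\<lambda>n. 1 - real (card (?lo n)) / real (card (?S n)) - real (card (?hi n)) / real (card (?S n))) \<longlonglongrightarrow> 1 - 0 - 0"
      using P by (intro tendsto_diff tendsto_const small_max_clique_prob_tendsto[OF assms]
          large_max_clique_prob_tendsto[OF r0]) auto
    then show "(\<lambda>n. 1 - real (card (?lo n)) / real (card (?S n)) - real (card (?hi n)) / real (card (?S n))) \<longlonglongrightarrow> 1"
      by simp
    show "\<forall>\<^sub>F n in sequentially. 1 - real (card (?lo n)) / real (card (?S n)) - real (card (?hi n)) / real (card (?S n))
        \<le> measure_pmf.prob (pmf_of_set (?S n)) (?good n)"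
    proof (intro always_eventually allI)
      fix n
      have fin: "finite (?S n)" and ne: "?S n \<noteq> {}"
        using finite_ordered_matchings ordered_matchings_nonempty[OF r0] by auto
      have pos: "real (card (?S n)) > 0" using fin ne by (simp add: card_gt_0_iff)
      \<comment> \<open>Every matching is good, too low or too high, so subadditivity bounds the
        share of good ones from below.\<close>
      have "card (?S n) \<le> card ((?S n \<inter> ?good n) \<union> (?lo n \<union> ?hi n))"
        using fin by (intro card_mono) auto
      also have "\<dots> \<le> card (?S n \<inter> ?good n) + card (?lo n \<union> ?hi n)" by (rule card_Un_le)
      also have "\<dots> \<le> card (?S n \<inter> ?good n) + (card (?lo n) + card (?hi n))"
        by (intro add_left_mono card_Un_le)
      finally have "real (card (?S n)) - real (card (?lo n)) - real (card (?hi n)) \<le> real (card (?S n \<inter> ?good n))"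
        by linarith
      then have "(real (card (?S n)) - real (card (?lo n)) - real (card (?hi n))) / real (card (?S n))
          \<le> real (card (?S n \<inter> ?good n)) / real (card (?S n))"
        by (rule divide_right_mono) simp
      then show "1 - real (card (?lo n)) / real (card (?S n)) - real (card (?hi n)) / real (card (?S n))
        \<le> measure_pmf.prob (pmf_of_set (?S n)) (?good n)"
        using pos by (simp only: measure_pmf_of_set[OF ne fin] diff_divide_distrib divide_self_if) auto
    qed
  qed auto
qed

end
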